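(* All mixing rank-one $\mathbb{Z}$-actions are IC-rigid. That is, if $(X,\sigma,\mu)$ is a rank-one map which is mixing, then the $\mathbb{Z}$-action on $X$ generated by $\sigma$ is IC-rigid.
   Context: **Rank-one maps (as subshifts).** For a (finite, infinite or bi-infinite) $0$-$1$ word $x$ and nonnegative integers $a<b$ write $x[a,b]=(x_a,x_{a+1},\dots,x_{b-1})$. Let $(q_n)_{n\ge1}$ be an infinite sequence of positive integers and $(a_{n,j})_{n\ge 1,\,1\le j\le q_n}$ non-negative integers. Put $\omega_0=1$ (the one-letter word), and let $\omega_n$ be the concatenation of $q_n$ copies of $\omega_{n-1}$, where the $j$-th copy is followed immediately by $a_{n,j}$ zeroes. Let $h_n$ be the length of $\omega_n$. Let $X\subset\{0,1\}^{\mathbb{Z}}$ be the subshift of all bi-infinite words all of whose finite subwords are subwords of some $\omega_n$, and let $\sigma$ be the shift on $X$. There is a point $x\in X$ with $x[0,h_n]=\omega_n$ for all $n$; it is transitive in $X$, and it is generic for the probability measure $\mu$ on $X$ given by $\mu([w])=\lim_{n\to\infty}\frac1{h_n}\#\{i\in[0,h_n):x[i,i+\ell]=w\}$ for every word $w$ of length $\ell$, where $[w]=\{y\in X:y[0,\ell]=w\}$. The triple $(X,\sigma,\mu)$ is called a rank-one map (rank-one $\mathbb{Z}$-action). **Mixing.** $(X,\sigma,\mu)$ is mixing if $\lim_{n\to\infty}\mu(A\cap\sigma^nB)=\mu(A)\mu(B)$ for all Borel sets $A,B\subset X$. **IC-rigidity.** For a compact metric space $X$ let $\mathcal{K}(X)$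 be the space of nonempty compact subsets of $X$ with the Hausdorff metric, and $\mathcal{K}_{\mathrm{fin}}(X)$ the set of nonempty finite subsets. A continuous action of a discrete abelian group $G$ on $X$ induces an action on $\mathcal{K}(X)$ by $gK=\{gx:x\in K\}$. The action is IC-rigid if every Borel probability measure $\nu$ on $\mathcal{K}(X)$ invariant under the induced action satisfies $\nu(\mathcal{K}_{\mathrm{fin}}(X)\cup\{X\})=1$, where $\{X\}$ denotes the one-element subset of $\mathcal{K}(X)$ whose element is $X$.
   Formalization: The formal theorem assumes in addition μ([1]) > 0, i.e. that μ is not the point mass at the zero sequence; without this the claim read literally fails, since that point mass is trivially mixing while IC-rigidity can fail. *)

theory Defs
  imports "HOL-Probability.Probability" "HOL-Library.Sublist"
begin

section \<open>Hyperspaces and IC-rigidity\<close>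

definition hyperspace :: "'a::metric_space set \<Rightarrow> 'a set set" where
  "hyperspace X = {K. K \<subseteq> X \<and> compact K \<and> K \<noteq> {}}"

definition fin_hyperspace :: "'a::metric_space set \<Rightarrow> 'a set set" where
  "fin_hyperspace X = {K. K \<subseteq> X \<and> finite K \<and> K \<noteq> {}}"

text \<open>The value 0 outside nonempty compact sets is a convention that makes the function
  nonnegative everywhere, as the locale \<^locale>\<open>Metric_space\<close> demands.\<close>

definition hausdorff_dist :: "'a::metric_space set \<Rightarrow> 'a set \<Rightarrow> real" where
  "hausdorff_dist A B =
     (if A \<in> hyperspace UNIV \<and> B \<in> hyperspace UNIV
      then max (SUP x\<in>A. infdist x B) (SUP y\<in>B. infdist y A) else 0)"

definition hyperspace_topology :: "'a::metric_space set \<Rightarrow> 'a set topology" where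
  "hyperspace_topology X = Metric_space.mtopology (hyperspace X) hausdorff_dist"

definition hyperspace_borel :: "'a::metric_space set \<Rightarrow> 'a set measure" where
  "hyperspace_borel X = sigma (hyperspace X) {U. openin (hyperspace_topology X) U}"

definition invariant_measure :: "('g \<Rightarrow> 'a \<Rightarrow> 'a) \<Rightarrow> 'a measure \<Rightarrow> bool" where
  "invariant_measure act N \<longleftrightarrow> (\<forall>g. act g \<in> measurable N N \<and> distr N N (act g) = N)"

text \<open>To be used for continuous actions of the discrete group \<^typ>\<open>'g\<close> on a compact set \<open>X\<close>,
  where \<open>act g x\<close> is the image of \<open>x\<close> under \<open>g\<close>.\<close>

definition IC_rigid :: "'a::metric_space set \<Rightarrow> ('g::ab_group_add \<Rightarrow> 'a \<Rightarrow> 'a) \<Rightarrow> bool" where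
  "IC_rigid X act \<longleftrightarrow>
     (\<forall>N. prob_space N \<longrightarrow> sets N = sets (hyperspace_borel X) \<longrightarrow>
          invariant_measure (\<lambda>g K. act g ` K) N \<longrightarrow>
          measure N (fin_hyperspace X \<union> {X}) = 1)"

lemma
  assumes A: "A \<in> hyperspace UNIV" and B: "B \<in> hyperspace UNIV"
  shows hausdorff_dist_upper1: "x \<in> A \<Longrightarrow> infdist x B \<le> hausdorff_dist A B"
    and hausdorff_dist_upper2: "y \<in> B \<Longrightarrow> infdist y A \<le> hausdorff_dist A B"
proof -
  have bdd: "bdd_above ((\<lambda>x. infdist x D) ` C)"
    if "C \<in> hyperspace UNIV" "D \<in> hyperspace UNIV" for C D :: "'a set"
  proof -
    have "compact ((\<lambda>x. infdist x D) ` C)"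
      using that by (intro compact_continuous_image continuous_intros) (auto simp: hyperspace_def)
    then show ?thesis by (simp add: bounded_imp_bdd_above compact_imp_bounded)
  qed
  show "infdist x B \<le> hausdorff_dist A B" if "x \<in> A"
    unfolding hausdorff_dist_def using A B cSUP_upper[OF that bdd[OF A B]] by auto
  show "infdist y A \<le> hausdorff_dist A B" if "y \<in> B"
    unfolding hausdorff_dist_def using A B cSUP_upper[OF that bdd[OF B A]] by auto
qed

lemma hausdorff_dist_least:
  assumes "A \<in> hyperspace UNIV" "B \<in> hyperspace UNIV"
    and "\<And>x. x \<in> A \<Longrightarrow> infdist x B \<le> r" "\<And>y. y \<in> B \<Longrightarrow> infdist y A \<le> r"
  shows "hausdorff_dist A B \<le> r"
proof -
  have "A \<noteq> {}" "B \<noteq> {}" using assms(1,2) by (auto simp: hyperspace_def)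
  then show ?thesis unfolding hausdorff_dist_def using assms by (auto intro!: cSUP_least)
qed

lemma hausdorff_dist_commute: "hausdorff_dist A B = hausdorff_dist B A"
  by (auto simp: hausdorff_dist_def max.commute)

lemma hausdorff_dist_nonneg: "0 \<le> hausdorff_dist A B"
proof (cases "A \<in> hyperspace UNIV \<and> B \<in> hyperspace UNIV")
  case True
  then obtain x where "x \<in> A" by (auto simp: hyperspace_def)
  with True hausdorff_dist_upper1[of A B x] infdist_nonneg[of x B] show ?thesis by linarith
next
  case False
  then show ?thesis by (auto simp: hausdorff_dist_def)
qed

lemma infdist_le_hausdorff_dist:
  assumes "B \<in> hyperspace UNIV" "C \<in> hyperspace UNIV"
  shows "infdist x C \<le> infdist x B + hausdorff_dist B C"
proof -
  have "B \<noteq> {}" using assms(1) by (auto simp: hyperspace_def)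
  moreover have "infdist x C - hausdorff_dist B C \<le> dist x b" if "b \<in> B" for b
    using hausdorff_dist_upper1[OF assms that] infdist_triangle[of x C b] by linarith
  ultimately have "infdist x C - hausdorff_dist B C \<le> infdist x B"
    by (simp add: infdist_notempty cINF_greatest)
  then show ?thesis by linarith
qed

lemma Metric_space_hyperspace: "Metric_space (hyperspace X) hausdorff_dist"
proof
  fix A B C :: "'a set"
  show "0 \<le> hausdorff_dist A B" by (rule hausdorff_dist_nonneg)
  show "hausdorff_dist A B = hausdorff_dist B A" by (rule hausdorff_dist_commute)
  assume "A \<in> hyperspace X" "B \<in> hyperspace X"
  then have A: "A \<in> hyperspace UNIV" and B: "B \<in> hyperspace UNIV"
    by (auto simp: hyperspace_def)
  show "hausdorff_dist A B = 0 \<longleftrightarrow> A = B"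
  proof
    assume 0: "hausdorff_dist A B = 0"
    have "infdist x B = 0" if "x \<in> A" for x
      using hausdorff_dist_upper1[OF A B that] 0 infdist_nonneg[of x B] by linarith
    moreover have "infdist y A = 0" if "y \<in> B" for y
      using hausdorff_dist_upper2[OF A B that] 0 infdist_nonneg[of y A] by linarith
    moreover have "closed A" "closed B" "A \<noteq> {}" "B \<noteq> {}"
      using A B by (auto simp: hyperspace_def compact_imp_closed)
    ultimately show "A = B" using in_closed_iff_infdist_zero by blast
  next
    assume "A = B"
    then have "hausdorff_dist A B \<le> 0" by (auto intro!: hausdorff_dist_least A B)
    then show "hausdorff_dist A B = 0" using hausdorff_dist_nonneg[of A B] by linarith
  qed
  assume "C \<in> hyperspace X"
  then have C: "C \<in> hyperspace UNIV" by (auto simp: hyperspace_def)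
  show "hausdorff_dist A C \<le> hausdorff_dist A B + hausdorff_dist B C"
  proof (rule hausdorff_dist_least[OF A C])
    fix x assume "x \<in> A"
    then show "infdist x C \<le> hausdorff_dist A B + hausdorff_dist B C"
      using infdist_le_hausdorff_dist[OF B C, of x] hausdorff_dist_upper1[OF A B, of x] by linarith
  next
    fix y assume "y \<in> C"
    then show "infdist y A \<le> hausdorff_dist A B + hausdorff_dist B C"
      using infdist_le_hausdorff_dist[OF B A, of y] hausdorff_dist_upper2[OF B C, of y]
        hausdorff_dist_commute[of A B] by linarith
  qed
qed

section \<open>Rank-one subshifts\<close>

instantiation nat :: metric_space
begin

definition dist_nat :: "nat \<Rightarrow> nat \<Rightarrow> real" where
  "dist_nat m n = \<bar>real m - real n\<bar>"

definition uniformity_nat :: "(nat \<times> nat) filter" where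
  "uniformity_nat = (INF e\<in>{0<..}. principal {(x, y). dist x y < e})"

instance
proof
  fix U :: "nat set" and x y z :: nat
  show "(uniformity :: (nat \<times> nat) filter) = (INF e\<in>{0<..}. principal {(x, y). dist x y < e})"
    by (rule uniformity_nat_def)
  have "\<forall>\<^sub>F (x', y) in (uniformity :: (nat \<times> nat) filter). x' = x \<longrightarrow> y \<in> U" if "x \<in> U" for x
  proof -
    have "\<forall>\<^sub>F p in (uniformity :: (nat \<times> nat) filter). p \<in> {(x, y). dist x y < 1}"
      unfolding uniformity_nat_def by (rule eventually_INF1[of 1]) (auto simp: eventually_principal)
    moreover have "x' = x \<longrightarrow> y \<in> U" if "dist x' y < 1" for x' y :: nat
    proof -
      have "x' = y" using that by (simp add: dist_nat_def)
      then show ?thesis using \<open>x \<in> U\<close> by simp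
    qed
    ultimately show ?thesis by (auto elim!: eventually_mono)
  qed
  then show "open U \<longleftrightarrow>
      (\<forall>x\<in>U. \<forall>\<^sub>F (x', y) in (uniformity :: (nat \<times> nat) filter). x' = x \<longrightarrow> y \<in> U)"
    by (simp add: Topological_Spaces.open_discrete)
  show "dist x y = 0 \<longleftrightarrow> x = y" "dist x y \<le> dist x z + dist y z"
    by (auto simp: dist_nat_def)
qed

end

text \<open>Words are lists over \<open>{0, 1}\<close> and bi-infinite words are functions \<^typ>\<open>int \<Rightarrow> nat\<close>, which
  carry the product topology, metrized by the library's metric on countable products. Of the parameters \<open>q\<close> and \<open>a\<close> only \<open>q n\<close> and \<open>a n j\<close> with
  \<open>n \<ge> 1\<close> and \<open>1 \<le> j \<le> q n\<close> are used.\<close>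

fun omega :: "(nat \<Rightarrow> nat) \<Rightarrow> (nat \<Rightarrow> nat \<Rightarrow> nat) \<Rightarrow> nat \<Rightarrow> nat list" where
  "omega q a 0 = [1]"
| "omega q a (Suc n) =
     concat (map (\<lambda>j. omega q a n @ replicate (a (Suc n) j) 0) [1..<Suc (q (Suc n))])"

definition subword :: "(int \<Rightarrow> nat) \<Rightarrow> int \<Rightarrow> int \<Rightarrow> nat list" where
  "subword x i j = map x [i..j - 1]"

definition rank_one_subshift :: "(nat \<Rightarrow> nat) \<Rightarrow> (nat \<Rightarrow> nat \<Rightarrow> nat) \<Rightarrow> (int \<Rightarrow> nat) set" where
  "rank_one_subshift q a = {y. \<forall>i j. i < j \<longrightarrow> (\<exists>n. sublist (subword y i j) (omega q a n))}"

definition cylinder :: "(int \<Rightarrow> nat) set \<Rightarrow> nat list \<Rightarrow> (int \<Rightarrow> nat) set" where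
  "cylinder X w = {y \<in> X. subword y 0 (int (length w)) = w}"

definition left_shift :: "(int \<Rightarrow> nat) \<Rightarrow> int \<Rightarrow> nat" where
  "left_shift x = (\<lambda>k. x (k + 1))"

definition shift_action :: "int \<Rightarrow> (int \<Rightarrow> nat) \<Rightarrow> int \<Rightarrow> nat" where
  "shift_action m x = (\<lambda>k. x (k + m))"

lemma shift_action_1: "shift_action 1 = left_shift"
  by (simp add: fun_eq_iff shift_action_def left_shift_def)

lemma shift_action_0: "shift_action 0 x = x"
  by (simp add: shift_action_def)

lemma shift_action_add: "shift_action (m + n) x = shift_action m (shift_action n x)"
  by (simp add: shift_action_def algebra_simps)

lemma left_shift_funpow: "left_shift ^^ n = shift_action (int n)"
  by (induction n) (auto simp: fun_eq_iff shift_action_def left_shift_def algebra_simps)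

lemma continuous_on_shift_action: "continuous_on S (shift_action m)"
  unfolding shift_action_def
  by (intro continuous_on_coordinatewise_then_product continuous_on_product_coordinates
        continuous_on_subset[OF _ subset_UNIV])

lemma shift_action_rank_one_subshift:
  "shift_action m ` rank_one_subshift q a = rank_one_subshift q a"
proof -
  have *: "subword (shift_action m y) i j = subword y (i + m) (j + m)" for m y i j
    unfolding subword_def shift_action_def
    by (rule nth_equalityI) (auto simp: algebra_simps)
  have sub: "shift_action m ` rank_one_subshift q a \<subseteq> rank_one_subshift q a" for m
    by (auto simp: rank_one_subshift_def *)
  have "y \<in> shift_action m ` rank_one_subshift q a" if "y \<in> rank_one_subshift q a" for y
  proof
    show "y = shift_action m (shift_action (- m) y)"
      by (simp add: shift_action_def)
    show "shift_action (- m) y \<in> rank_one_subshift q a" using sub that by blast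
  qed
  with sub[of m] show ?thesis by blast
qed

lemma set_omega: "set (omega q a n) \<subseteq> {0, 1}"
  by (induction n) auto

lemma compact_rank_one_subshift: "compact (rank_one_subshift q a)"
proof -
  have "compact (PiE UNIV (\<lambda>_::int. {0, 1::nat}))"
    using compactin_PiE[of "\<lambda>_::int. euclidean" UNIV "\<lambda>_. {0, 1::nat}"]
    by (simp add: euclidean_product_topology)
  moreover have "rank_one_subshift q a \<subseteq> PiE UNIV (\<lambda>_. {0, 1})"
  proof
    fix y assume "y \<in> rank_one_subshift q a"
    have "y i \<in> {0, 1}" for i
    proof -
      obtain n where "sublist (subword y i (i + 1)) (omega q a n)"
        using \<open>y \<in> rank_one_subshift q a\<close> by (force simp: rank_one_subshift_def)
      then have "set (subword y i (i + 1)) \<subseteq> {0, 1}"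
        using set_omega[of q a n] set_mono_sublist by blast
      then show ?thesis by (simp add: subword_def)
    qed
    then show "y \<in> PiE UNIV (\<lambda>_. {0, 1})" by (blast intro: PiE_I)
  qed
  moreover have "closed (rank_one_subshift q a)"
  proof -
    have "open {y. \<not> P (subword y i j)}" for P i j
    proof (subst open_subopen, intro ballI)
      fix y assume y: "y \<in> {y. \<not> P (subword y i j)}"
      let ?T = "\<Inter>k\<in>{i..j - 1}. (\<lambda>z::int \<Rightarrow> nat. z k) -` {y k}"
      have 1: "open ?T"
        by (intro open_INT ballI open_vimage continuous_on_product_coordinates)
          (auto intro: Topological_Spaces.open_discrete)
      have 2: "subword z i j = subword y i j" if "z \<in> ?T" for z
        using that by (auto simp: subword_def)
      have "?T \<subseteq> {y. \<not> P (subword y i j)}"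
      proof
        fix z assume "z \<in> ?T"
        from 2[OF this] y show "z \<in> {y. \<not> P (subword y i j)}" by simp
      qed
      moreover have "y \<in> ?T" by simp
      ultimately show "\<exists>T. open T \<and> y \<in> T \<and> T \<subseteq> {y. \<not> P (subword y i j)}"
        using 1 by blast
    qed
    then have closed: "closed {y. P (subword y i j)}" for P i j
      by (simp add: closed_def Collect_neg_eq)
    have "rank_one_subshift q a =
        (\<Inter>i. \<Inter>j\<in>{i<..}. {y. \<exists>n. sublist (subword y i j) (omega q a n)})"
      by (auto simp: rank_one_subshift_def)
    also have "closed \<dots>" by (intro closed_INT ballI closed)
    finally show ?thesis .
  qed
  ultimately show ?thesis
    using compact_Int_closed[of "PiE UNIV (\<lambda>_::int. {0, 1::nat})" "rank_one_subshift q a"]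
    by (simp add: inf_absorb2)
qed

text \<open>The word frequencies are those of a point extending all \<open>omega q a n\<close> to the right.
  If the letter 1 has frequency 0, as for cutting-and-stacking constructions of infinite total
  mass, the limit is the point mass at the zero sequence. Mixing is then trivial and IC-rigidity
  can fail. The definition admits this degenerate case; requiring the cylinder of \<open>[1]\<close> to have
  positive measure excludes it and nothing else.\<close>

definition rank_one_map ::
    "(nat \<Rightarrow> nat) \<Rightarrow> (nat \<Rightarrow> nat \<Rightarrow> nat) \<Rightarrow> (int \<Rightarrow> nat) measure \<Rightarrow> bool" where
  "rank_one_map q a M \<longleftrightarrow>
     (\<forall>n\<ge>1. q n > 0) \<and>
     prob_space M \<and>
     sets M = sets (restrict_space borel (rank_one_subshift q a)) \<and>
     (\<exists>x \<in> rank_one_subshift q a.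
        (\<forall>n. subword x 0 (int (length (omega q a n))) = omega q a n) \<and>
        (\<forall>w. (\<lambda>n. real (card {i \<in> {0..<int (length (omega q a n))}.
                     subword x i (i + int (length w)) = w}) / real (length (omega q a n)))
             \<longlonglongrightarrow> measure M (cylinder (rank_one_subshift q a) w)))"

definition mixing :: "'a measure \<Rightarrow> ('a \<Rightarrow> 'a) \<Rightarrow> bool" where
  "mixing M T \<longleftrightarrow>
     (\<forall>A\<in>sets M. \<forall>B\<in>sets M.
        (\<lambda>n. measure M (A \<inter> (T ^^ n) ` B)) \<longlonglongrightarrow> measure M A * measure M B)"

end

theory Submission
  imports Defs
begin

text \<open>
  Let \<open>K\<close> be a random infinite compact subset of \<open>X\<close> whose law \<open>\<nu>\<close>
  is shift-invariant, and let \<open>w\<close> be a word that occurs in \<open>X\<close>, of measure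
  \<open>u > 0\<close>. The point is that almost surely some element of \<open>K\<close> has an occurrence of
  \<open>w\<close> at time \<open>0\<close>. By invariance the same holds at every time, so \<open>K\<close>
  almost surely meets all of the countably many nonempty cylinders of \<open>X\<close>, which forces
  \<open>K = X\<close>. By invariance again, the probability that \<open>K\<close> misses \<open>w\<close> at
  time \<open>0\<close> is the mean proportion of times \<open>t \<in> [0, h n)\<close> at which
  \<open>K\<close> misses \<open>w\<close>, where \<open>h n\<close> is the length of
  \<open>\<omega>\<^sub>n = omega q a n\<close>. This proportion is estimated for each \<open>K\<close>
  separately, for large \<open>n\<close>.

  Each element of \<open>K\<close> is a concatenation of copies of \<open>\<omega>\<^sub>n\<close> and zeros.
  Take together the starts of all these copies, for all elements of \<open>K\<close>, and fix a small multiple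
  \<open>e\<close> of \<open>h n\<close> and a large number \<open>Q\<close>. Call a time rich if at least
  \<open>Q\<close> of the copies contain its \<open>e\<close>-neighbourhood.

  Near a rich time, \<open>K\<close> misses \<open>w\<close> only when none of \<open>Q\<close> differently
  displaced copies of one and the same word \<open>\<omega>\<^sub>n\<close> shows \<open>w\<close>. By mixing,
  the occurrences of \<open>w\<close> in \<open>\<omega>\<^sub>n\<close> and in
  \<open>\<omega>\<^sub>n\<close> displaced by \<open>d\<close> are almost uncorrelated, uniformly in
  \<open>n\<close> and in \<open>d \<ge> D\<close> (lemma \<open>correlation_small\<close>). A second-moment
  argument then bounds the number of such times (lemma \<open>common_gaps_few\<close>). The correlations in
  question run over the overlap of the two copies only, which varies with \<open>n\<close> and
  \<open>d\<close>, so mixing does not apply to them directly. Instead, they are averaged along an arithmetic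
  progression of translates; the square of the averaged function is nonnegative, so its sum over the overlap
  is at most its sum over everything, which is an integral (lemma \<open>tower_bound\<close>), and that
  integral is small by mixing.

  At a time that is not rich, either \<open>K\<close> shows few patterns in the surrounding window of radius
  \<open>m\<close>, or many copies begin or end at a distance of order \<open>e\<close> from this time. In the
  latter case these copies stretch over almost \<open>h n\<close> on one side, where all times are then rich;
  hence only \<open>O(e)\<close> times in \<open>[0, h n)\<close> are of this kind (lemma
  \<open>poor_times_few\<close>). The number of patterns that counts as few depends on \<open>Q\<close> but
  not on \<open>m\<close>, and an infinite \<open>K\<close> shows arbitrarily many patterns as
  \<open>m\<close> grows, so letting \<open>m\<close> tend to infinity removes the first alternative.
\<close>

section \<open>Decomposition into blocks\<close>

definition block_starts :: "nat list \<Rightarrow> nat list \<Rightarrow> nat set \<Rightarrow> bool" where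
  "block_starts b v S \<longleftrightarrow>
     (\<forall>s\<in>S. s + length b \<le> length v \<and> (\<forall>k<length b. v ! (s + k) = b ! k)) \<and>
     (\<forall>p<length v. v ! p \<noteq> 0 \<longrightarrow> (\<exists>s\<in>S. s \<le> p \<and> p < s + length b)) \<and>
     (\<forall>s\<in>S. \<forall>s'\<in>S. s < s' \<longrightarrow> s + length b \<le> s')"

lemma block_starts_self: "block_starts b b {0}"
  by (auto simp: block_starts_def)

lemma block_starts_zeros: "block_starts b (replicate k 0) {}"
  by (auto simp: block_starts_def)

lemma block_starts_append:
  assumes "block_starts b v S" "block_starts b v' S'"
  shows "block_starts b (v @ v') (S \<union> (+) (length v) ` S')"
  unfolding block_starts_def
proof (intro conjI ballI allI impI)
  fix s assume s: "s \<in> S \<union> (+) (length v) ` S'"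
  show "s + length b \<le> length (v @ v')"
    using s assms by (fastforce simp: block_starts_def)
  fix k assume "k < length b"
  then show "(v @ v') ! (s + k) = b ! k"
    using s assms by (fastforce simp: block_starts_def nth_append)
next
  fix p assume p: "p < length (v @ v')" "(v @ v') ! p \<noteq> 0"
  show "\<exists>s\<in>S \<union> (+) (length v) ` S'. s \<le> p \<and> p < s + length b"
  proof (cases "p < length v")
    case True
    then show ?thesis using p assms(1) by (auto simp: block_starts_def nth_append)
  next
    case False
    then have "v' ! (p - length v) \<noteq> 0" "p - length v < length v'"
      using p by (auto simp: nth_append)
    then obtain s where "s \<in> S'" "s \<le> p - length v" "p - length v < s + length b"
      using assms(2) unfolding block_starts_def by blast
    then show ?thesis using False by (intro bexI[of _ "length v + s"]) auto
  qed
next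
  fix s s' assume "s \<in> S \<union> (+) (length v) ` S'" "s' \<in> S \<union> (+) (length v) ` S'" "s < s'"
  then show "s + length b \<le> s'"
    using assms by (fastforce simp: block_starts_def)
qed

lemma block_starts_concat:
  assumes "\<And>v. v \<in> set vs \<Longrightarrow> \<exists>S. block_starts b v S"
  shows "\<exists>S. block_starts b (concat vs) S"
  using assms
proof (induction vs)
  case Nil
  then show ?case using block_starts_zeros[of b 0] by auto
next
  case (Cons v vs)
  then obtain S S' where "block_starts b v S" "block_starts b (concat vs) S'" by (metis list.set_intros)
  then show ?case using block_starts_append[of b v S "concat vs" S'] by auto
qed

lemma block_starts_omega: "n \<le> k \<Longrightarrow> \<exists>S. block_starts (omega q a n) (omega q a k) S"
proof (induction k rule: dec_induct)
  case base
  then show ?case using block_starts_self by blast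
next
  case (step k)
  then show ?case
    unfolding omega.simps by (intro block_starts_concat) (use block_starts_append block_starts_zeros in fastforce)
qed

lemma prefix_omega_Suc:
  assumes "q (Suc n) > 0" shows "prefix (omega q a n) (omega q a (Suc n))"
proof -
  have "[1..<Suc (q (Suc n))] = 1 # [2..<Suc (q (Suc n))]"
    using assms by (simp add: upt_rec numeral_2_eq_2)
  then show ?thesis by (simp add: prefix_def)
qed

lemma prefix_omega:
  assumes "\<And>n. n \<ge> 1 \<Longrightarrow> q n > 0" and "n \<le> k"
  shows "prefix (omega q a n) (omega q a k)"
  using assms(2)
proof (induction k rule: dec_induct)
  case base
  then show ?case by simp
next
  case (step k)
  have "prefix (omega q a k) (omega q a (Suc k))"
    using assms(1)[of "Suc k"] by (intro prefix_omega_Suc) simp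
  then show ?case using step.IH prefix_order.trans by blast
qed

lemma length_subword [simp]: "length (subword y i j) = nat (j - i)"
  by (simp add: subword_def)

lemma nth_subword: "k < nat (j - i) \<Longrightarrow> subword y i j ! k = y (i + int k)"
  by (simp add: subword_def)

lemma subword_shift: "subword (shift_action m y) i j = subword y (i + m) (j + m)"
  by (rule nth_equalityI) (auto simp: nth_subword shift_action_def algebra_simps)

lemma subword_eq_iff:
  "subword y i (i + int (length w)) = w \<longleftrightarrow> (\<forall>k<length w. y (i + int k) = w ! k)"
  by (auto simp: list_eq_iff_nth_eq nth_subword)

lemma subword_eq_subword_iff:
  "subword y i j = subword z i j \<longleftrightarrow> (\<forall>p. i \<le> p \<and> p < j \<longrightarrow> y p = z p)"
  unfolding subword_def by auto

text \<open>A trace of such a decomposition on a window of a bi-infinite word. Copies may stick out of the window, which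
  is why only the letters inside it are compared.\<close>

definition block_cover :: "nat list \<Rightarrow> int \<Rightarrow> int \<Rightarrow> (int \<Rightarrow> nat) \<Rightarrow> int set \<Rightarrow> bool" where
  "block_cover b i j y S \<longleftrightarrow>
     (\<forall>s\<in>S. \<forall>u<length b. i \<le> s + int u \<longrightarrow> s + int u < j \<longrightarrow> y (s + int u) = b ! u) \<and>
     (\<forall>p. i \<le> p \<longrightarrow> p < j \<longrightarrow> y p \<noteq> 0 \<longrightarrow> (\<exists>s\<in>S. s \<le> p \<and> p < s + int (length b)))"

text \<open>Every window of \<open>y\<close> is part of some \<open>\<omega>\<^sub>k\<close>, where
  \<open>k \<ge> n\<close> can be assumed because \<open>\<omega>\<^sub>k\<close> is a prefix of
  \<open>\<omega>\<^sub>n\<close> for \<open>k \<le> n\<close>; the decomposition of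
  \<open>\<omega>\<^sub>k\<close> is then restricted to the window.\<close>

lemma block_cover_exists:
  assumes "\<And>n. n \<ge> 1 \<Longrightarrow> q n > 0" and y: "y \<in> rank_one_subshift q a"
  shows "\<exists>S. block_cover (omega q a n) i j y S"
proof (cases "i < j")
  case False
  then show ?thesis by (auto simp: block_cover_def intro!: exI[of _ "{}"])
next
  case True
  then obtain k0 where "sublist (subword y i j) (omega q a k0)"
    using y by (auto simp: rank_one_subshift_def)
  then have "sublist (subword y i j) (omega q a (max n k0))"
    using prefix_omega[of q k0 "max n k0" a] assms(1) by (meson max.cobounded2 prefix_imp_sublist sublist_order.order.trans)
  then obtain ps ss where k: "omega q a (max n k0) = ps @ subword y i j @ ss"
    by (auto simp: sublist_def)
  obtain S where S: "block_starts (omega q a n) (omega q a (max n k0)) S"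
    using block_starts_omega[of n "max n k0" q a] by auto
  have yp: "y p = omega q a (max n k0) ! nat (p - i + int (length ps))"
    "nat (p - i + int (length ps)) < length (omega q a (max n k0))" if "i \<le> p" "p < j" for p
  proof -
    have *: "nat (p - i + int (length ps)) = length ps + nat (p - i)" using that by auto
    show "y p = omega q a (max n k0) ! nat (p - i + int (length ps))"
      unfolding k * using that by (simp add: nth_append nth_subword)
    show "nat (p - i + int (length ps)) < length (omega q a (max n k0))"
      unfolding k * using that by simp
  qed
  let ?S = "(\<lambda>s. int s + i - int (length ps)) ` S"
  have "block_cover (omega q a n) i j y ?S"
    unfolding block_cover_def
  proof (intro conjI ballI allI impI)
    fix s u assume *: "s \<in> ?S" "u < length (omega q a n)" "i \<le> s + int u" "s + int u < j"
    then obtain s' where s': "s' \<in> S" "s = int s' + i - int (length ps)" by auto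
    have "nat (s + int u - i + int (length ps)) = s' + u" using s' by auto
    then show "y (s + int u) = omega q a n ! u"
      using yp(1)[OF *(3,4)] S s'(1) *(2) by (simp add: block_starts_def)
  next
    fix p assume p: "i \<le> p" "p < j" "y p \<noteq> 0"
    then obtain s where "s \<in> S" "s \<le> nat (p - i + int (length ps))"
       "nat (p - i + int (length ps)) < s + length (omega q a n)"
      using S yp[OF p(1,2)] unfolding block_starts_def by metis
    then show "\<exists>s\<in>?S. s \<le> p \<and> p < s + int (length (omega q a n))"
      using p(1) by (intro bexI[of _ "int s + i - int (length ps)"]) auto
  qed
  then show ?thesis by blast
qed

section \<open>Functions of finitely many coordinates\<close>

definition depends_on_window :: "nat \<Rightarrow> ((int \<Rightarrow> nat) \<Rightarrow> real) \<Rightarrow> bool" where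
  "depends_on_window l \<Phi> \<longleftrightarrow> (\<forall>y z. (\<forall>k<l. y (int k) = z (int k)) \<longrightarrow> \<Phi> y = \<Phi> z)"

lemma depends_on_windowD:
  "depends_on_window l \<Phi> \<Longrightarrow> (\<And>k. k < l \<Longrightarrow> y (int k) = z (int k)) \<Longrightarrow> \<Phi> y = \<Phi> z"
  by (auto simp: depends_on_window_def)

lemma depends_on_window_mono: "depends_on_window l \<Phi> \<Longrightarrow> l \<le> l' \<Longrightarrow> depends_on_window l' \<Phi>"
  by (auto simp: depends_on_window_def)

lemma depends_on_window_const: "depends_on_window l (\<lambda>_. c)"
  by (auto simp: depends_on_window_def)

lemma depends_on_window_compose2:
  assumes "depends_on_window l \<Phi>" "depends_on_window l \<Psi>"
  shows "depends_on_window l (\<lambda>y. F (\<Phi> y) (\<Psi> y))"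
  unfolding depends_on_window_def
proof (intro allI impI)
  fix y z :: "int \<Rightarrow> nat" assume "\<forall>k<l. y (int k) = z (int k)"
  then have "\<Phi> y = \<Phi> z" "\<Psi> y = \<Psi> z"
    using assms unfolding depends_on_window_def by blast+
  then show "F (\<Phi> y) (\<Psi> y) = F (\<Phi> z) (\<Psi> z)" by simp
qed

lemma depends_on_window_sum:
  assumes "\<And>i. i \<in> I \<Longrightarrow> depends_on_window l (\<Phi> i)"
  shows "depends_on_window l (\<lambda>y. \<Sum>i\<in>I. \<Phi> i y)"
  unfolding depends_on_window_def
proof (intro allI impI sum.cong refl)
  fix y z :: "int \<Rightarrow> nat" and i assume "\<forall>k<l. y (int k) = z (int k)" "i \<in> I"
  then show "\<Phi> i y = \<Phi> i z"
    using assms unfolding depends_on_window_def by blast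
qed

lemma depends_on_window_shift:
  assumes "depends_on_window l \<Phi>"
  shows "depends_on_window (l + d) (\<lambda>y. \<Phi> (shift_action (int d) y))"
  unfolding depends_on_window_def
proof (intro allI impI)
  fix y z :: "int \<Rightarrow> nat" assume *: "\<forall>k<l + d. y (int k) = z (int k)"
  show "\<Phi> (shift_action (int d) y) = \<Phi> (shift_action (int d) z)"
  proof (rule depends_on_windowD[OF assms])
    fix k assume "k < l"
    then show "shift_action (int d) y (int k) = shift_action (int d) z (int k)"
      using *[rule_format, of "k + d"] by (simp add: shift_action_def)
  qed
qed

definition binary_words :: "nat \<Rightarrow> nat list set" where
  "binary_words l = {w. set w \<subseteq> {0, 1} \<and> length w = l}"

lemma finite_binary_words: "finite (binary_words l)"
  unfolding binary_words_def by (rule finite_lists_length_eq) simp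

text \<open>Zeros fill up the word; functions of the first \<open>length w\<close> coordinates do not see them.\<close>

definition extend :: "nat list \<Rightarrow> int \<Rightarrow> nat" where
  "extend w = (\<lambda>k. if 0 \<le> k \<and> k < int (length w) then w ! nat k else 0)"

lemma rank_one_subshift_binary:
  assumes "y \<in> rank_one_subshift q a" shows "y i \<in> {0, 1}"
proof -
  obtain n where "sublist (subword y i (i + 1)) (omega q a n)"
    using assms by (force simp: rank_one_subshift_def)
  then have "set (subword y i (i + 1)) \<subseteq> {0, 1}"
    using set_omega[of q a n] set_mono_sublist by blast
  then show ?thesis by (simp add: subword_def)
qed

lemma subword_in_binary_words:
  assumes "y \<in> rank_one_subshift q a" shows "subword y i j \<in> binary_words (nat (j - i))"
  using rank_one_subshift_binary[OF assms] by (force simp: binary_words_def subword_def)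

text \<open>On the binary subshift, a function of finitely many coordinates is a finite combination of indicators of
  cylinders. In this way statements about cylinders carry over to such functions.\<close>

lemma window_function_expansion:
  assumes "depends_on_window l \<Phi>" "y \<in> rank_one_subshift q a"
  shows "\<Phi> y = (\<Sum>w\<in>binary_words l. \<Phi> (extend w) * indicator (cylinder (rank_one_subshift q a) w) y)"
proof -
  let ?w = "subword y 0 (int l)"
  have w: "?w \<in> binary_words l" using subword_in_binary_words[OF assms(2), of 0 "int l"] by simp
  have "\<Phi> y = \<Phi> (extend ?w)"
    by (rule depends_on_windowD[OF assms(1)]) (simp add: extend_def nth_subword)
  also have "\<dots> = (\<Sum>w\<in>binary_words l. if w = ?w then \<Phi> (extend w) else 0)"
    using w finite_binary_words by simp
  also have "\<dots> = (\<Sum>w\<in>binary_words l. \<Phi> (extend w) * indicator (cylinder (rank_one_subshift q a) w) y)"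
    by (rule sum.cong) (use assms(2) in \<open>auto simp: cylinder_def binary_words_def\<close>)
  finally show ?thesis .
qed

definition occurs :: "nat list \<Rightarrow> (int \<Rightarrow> nat) \<Rightarrow> real" where
  "occurs w y = (if subword y 0 (int (length w)) = w then 1 else 0)"

lemma occurs_nonneg: "0 \<le> occurs w y"
  by (simp add: occurs_def)

lemma depends_on_window_occurs: "depends_on_window (length w) (occurs w)"
  unfolding depends_on_window_def
proof (intro allI impI)
  fix y z :: "int \<Rightarrow> nat" assume "\<forall>k<length w. y (int k) = z (int k)"
  then show "occurs w y = occurs w z"
    using subword_eq_iff[of y 0 w] subword_eq_iff[of z 0 w] by (simp add: occurs_def)
qed

section \<open>Mixing and the tower bound\<close>

text \<open>The generic point \<open>x\<close> is fixed because it starts with every \<open>\<omega>\<^sub>n\<close>: sums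
  over positions of a block become sums along the orbit of \<open>x\<close>.\<close>

locale mixing_rank_one =
  fixes q :: "nat \<Rightarrow> nat" and a :: "nat \<Rightarrow> nat \<Rightarrow> nat" and M :: "(int \<Rightarrow> nat) measure"
    and x :: "int \<Rightarrow> nat"
  assumes q_pos: "\<And>n. n \<ge> 1 \<Longrightarrow> q n > 0"
    and prob: "prob_space M"
    and sets_M: "sets M = sets (restrict_space borel (rank_one_subshift q a))"
    and x_in: "x \<in> rank_one_subshift q a"
    and x_omega: "\<And>n. subword x 0 (int (length (omega q a n))) = omega q a n"
    and x_generic: "\<And>w. (\<lambda>n. real (card {i \<in> {0..<int (length (omega q a n))}.
                     subword x i (i + int (length w)) = w}) / real (length (omega q a n)))
             \<longlonglongrightarrow> measure M (cylinder (rank_one_subshift q a) w)"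
    and one_pos: "measure M (cylinder (rank_one_subshift q a) [1]) > 0"
    and mix: "mixing M left_shift"
begin

sublocale prob_space M by (rule prob)

abbreviation X where "X \<equiv> rank_one_subshift q a"
abbreviation h where "h n \<equiv> length (omega q a n)"

lemma x_nth: "k < h n \<Longrightarrow> x (int k) = omega q a n ! k"
  using subword_eq_iff[of x 0 "omega q a n"] x_omega[of n] by simp

lemma space_M: "space M = X"
  using sets_eq_imp_space_eq[OF sets_M] by (simp add: space_restrict_space)

lemma shift_in_X: "y \<in> X \<Longrightarrow> shift_action m y \<in> X"
  using shift_action_rank_one_subshift by blast

lemma shift_measurable: "shift_action m \<in> measurable M M"
proof -
  have "shift_action m \<in> measurable (restrict_space borel X) (restrict_space borel X)"
  proof (rule measurable_restrict_space2)
    show "shift_action m \<in> space (restrict_space borel X) \<rightarrow> X"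
      using shift_in_X by (auto simp: space_restrict_space)
    show "shift_action m \<in> borel_measurable (restrict_space borel X)"
      by (intro measurable_restrict_space1 borel_measurable_continuous_onI continuous_on_shift_action)
  qed
  then show ?thesis using measurable_cong_sets[OF sets_M sets_M] by blast
qed

lemma shift_image_eq: "B \<subseteq> X \<Longrightarrow> shift_action m ` B = {y \<in> X. shift_action (-m) y \<in> B}"
proof (intro equalityI subsetI)
  fix y assume "B \<subseteq> X" "y \<in> shift_action m ` B"
  then show "y \<in> {y \<in> X. shift_action (- m) y \<in> B}"
    using shift_in_X by (auto simp flip: shift_action_add simp: shift_action_0)
next
  fix y assume "y \<in> {y \<in> X. shift_action (- m) y \<in> B}"
  then show "y \<in> shift_action m ` B"
    by (intro image_eqI[of _ _ "shift_action (- m) y"])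
      (auto simp flip: shift_action_add simp: shift_action_0)
qed

lemma shift_image_sets:
  assumes "B \<in> sets M" shows "shift_action m ` B \<in> sets M"
proof -
  have "B \<subseteq> X" using sets.sets_into_space[OF assms] by (simp add: space_M)
  then have "shift_action m ` B = shift_action (- m) -` B \<inter> space M"
    using shift_image_eq by (auto simp: space_M)
  then show ?thesis using measurable_sets[OF shift_measurable assms] by simp
qed

text \<open>Mixing implies invariance: \<open>\<mu>(\<sigma>\<^sup>n C) \<rightarrow> \<mu>(C)\<close> for every
  measurable \<open>C\<close>, and for \<open>C = \<sigma>\<^sup>m B\<close> and \<open>C = B\<close> these
  are the same sequence up to a shift of the index.\<close>

lemma measure_shift_image:
  assumes B: "B \<in> sets M" shows "measure M (shift_action (int m) ` B) = measure M B"
proof -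
  have lim: "(\<lambda>n. measure M (shift_action (int n) ` C)) \<longlonglongrightarrow> measure M C" if C: "C \<in> sets M" for C
  proof -
    have "(\<lambda>n. measure M (space M \<inter> (left_shift ^^ n) ` C)) \<longlonglongrightarrow> measure M (space M) * measure M C"
      using mix C unfolding mixing_def by blast
    moreover have "space M \<inter> (left_shift ^^ n) ` C = shift_action (int n) ` C" for n
      using sets.sets_into_space[OF shift_image_sets[OF C, of "int n"]]
      by (auto simp: left_shift_funpow)
    ultimately show ?thesis by (simp add: prob_space)
  qed
  have "(\<lambda>n. measure M (shift_action (int n) ` shift_action (int m) ` B))
      \<longlonglongrightarrow> measure M (shift_action (int m) ` B)"
    by (rule lim[OF shift_image_sets[OF B]])
  moreover have "shift_action (int n) ` shift_action (int m) ` B = shift_action (int (n + m)) ` B" for n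
    by (simp add: image_image flip: shift_action_add)
  moreover have "(\<lambda>n. measure M (shift_action (int (n + m)) ` B)) \<longlonglongrightarrow> measure M B"
    using LIMSEQ_ignore_initial_segment[OF lim[OF B], of m] .
  ultimately show ?thesis using LIMSEQ_unique by (metis (no_types, lifting) ext)
qed

text \<open>Mixing is a statement about images; invariance turns it into one about preimages, that is, about correlations
  of functions.\<close>

lemma mixing_sets:
  assumes A: "A \<in> sets M" and B: "B \<in> sets M"
  shows "(\<lambda>n. measure M (B \<inter> {y \<in> X. shift_action (int n) y \<in> A})) \<longlonglongrightarrow> measure M A * measure M B"
proof -
  have "measure M (B \<inter> {y \<in> X. shift_action (int n) y \<in> A}) = measure M (A \<inter> (left_shift ^^ n) ` B)" for n
  proof -
    have AX: "A \<subseteq> X" "B \<subseteq> X"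
      using A B by (auto dest!: sets.sets_into_space simp: space_M)
    have "{y \<in> X. shift_action (int n) y \<in> A} = shift_action (- int n) ` A"
      using shift_image_eq[OF AX(1), of "- int n"] by simp
    then have "B \<inter> {y \<in> X. shift_action (int n) y \<in> A} \<in> sets M"
      using shift_image_sets[OF A] B by simp
    from measure_shift_image[OF this, of n]
    have "measure M (B \<inter> {y \<in> X. shift_action (int n) y \<in> A}) =
       measure M (shift_action (int n) ` (B \<inter> {y \<in> X. shift_action (int n) y \<in> A}))" by simp
    also have "shift_action (int n) ` (B \<inter> {y \<in> X. shift_action (int n) y \<in> A}) = A \<inter> (left_shift ^^ n) ` B"
      using AX by (auto simp: left_shift_funpow)
    finally show ?thesis .
  qed
  then show ?thesis using mix A B unfolding mixing_def by simp
qed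

lemma cylinder_sets: "cylinder X w \<in> sets M"
proof -
  have "{y::int \<Rightarrow> nat. \<forall>k<length w. y (int k) = w ! k} = (\<Inter>k\<in>{..<length w}. (\<lambda>y. y (int k)) -` {w ! k})"
    by auto
  moreover have "(\<lambda>y::int \<Rightarrow> nat. y (int k)) -` {w ! k} \<in> sets borel" for k
    by (intro borel_open open_vimage continuous_on_product_coordinates)
      (auto intro: Topological_Spaces.open_discrete)
  ultimately have "{y::int \<Rightarrow> nat. \<forall>k<length w. y (int k) = w ! k} \<in> sets borel"
    by (cases "w = []") (auto intro!: sets.finite_INT)
  moreover have "cylinder X w = X \<inter> {y. \<forall>k<length w. y (int k) = w ! k}"
    using subword_eq_iff[of _ 0 w] by (auto simp: cylinder_def)
  ultimately show ?thesis unfolding sets_M by (auto simp: sets_restrict_space)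
qed

lemma
  assumes "depends_on_window l \<Phi>"
  shows window_function_integrable: "integrable M \<Phi>"
    and window_function_integral:
      "integral\<^sup>L M \<Phi> = (\<Sum>w\<in>binary_words l. \<Phi> (extend w) * measure M (cylinder X w))"
proof -
  let ?\<Psi> = "\<lambda>y. \<Sum>w\<in>binary_words l. \<Phi> (extend w) * indicator (cylinder X w) y"
  have eq: "\<Phi> y = ?\<Psi> y" if "y \<in> space M" for y
    using window_function_expansion[OF assms] that by (simp add: space_M)
  have int: "integrable M (\<lambda>y. \<Phi> (extend w) * indicator (cylinder X w) y)" for w
    using cylinder_sets by (simp add: integrable_real_indicator emeasure_eq_measure)
  have "integrable M ?\<Psi>" using int by (intro Bochner_Integration.integrable_sum)
  then show "integrable M \<Phi>" using Bochner_Integration.integrable_cong[of M M \<Phi> ?\<Psi>] eq by blast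
  have "integral\<^sup>L M \<Phi> = integral\<^sup>L M ?\<Psi>" using eq by (intro Bochner_Integration.integral_cong) auto
  also have "\<dots> = (\<Sum>w\<in>binary_words l. \<Phi> (extend w) * measure M (cylinder X w))"
    using int cylinder_sets by (simp add: Bochner_Integration.integral_sum)
  finally show "integral\<^sup>L M \<Phi> = \<dots>" .
qed

lemma window_function_mixing:
  assumes \<Phi>: "depends_on_window l \<Phi>" and \<Psi>: "depends_on_window l \<Psi>"
  shows "(\<lambda>d. integral\<^sup>L M (\<lambda>y. \<Phi> y * \<Psi> (shift_action (int d) y)))
           \<longlonglongrightarrow> integral\<^sup>L M \<Phi> * integral\<^sup>L M \<Psi>"
proof -
  let ?W = "binary_words l"
  define E where "E d w w' = cylinder X w \<inter> {y \<in> X. shift_action (int d) y \<in> cylinder X w'}" for d w w'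
  have E: "E d w w' \<in> sets M" for d w w'
  proof -
    have "{y \<in> X. shift_action (int d) y \<in> cylinder X w'} = shift_action (int d) -` cylinder X w' \<inter> space M"
      by (auto simp: space_M)
    then show ?thesis
      using measurable_sets[OF shift_measurable cylinder_sets, of "int d" w'] cylinder_sets
      by (simp add: E_def)
  qed
  have "integral\<^sup>L M (\<lambda>y. \<Phi> y * \<Psi> (shift_action (int d) y)) =
      (\<Sum>w\<in>?W. \<Sum>w'\<in>?W. \<Phi> (extend w) * \<Psi> (extend w') * measure M (E d w w'))" for d
  proof -
    have "integral\<^sup>L M (\<lambda>y. \<Phi> y * \<Psi> (shift_action (int d) y)) =
       integral\<^sup>L M (\<lambda>y. \<Sum>w\<in>?W. \<Sum>w'\<in>?W. \<Phi> (extend w) * \<Psi> (extend w') * indicator (E d w w') y)"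
    proof (rule Bochner_Integration.integral_cong[OF refl])
      fix y assume "y \<in> space M"
      then have y: "y \<in> X" "shift_action (int d) y \<in> X" using shift_in_X by (auto simp: space_M)
      show "\<Phi> y * \<Psi> (shift_action (int d) y) =
         (\<Sum>w\<in>?W. \<Sum>w'\<in>?W. \<Phi> (extend w) * \<Psi> (extend w') * indicator (E d w w') y)"
        unfolding window_function_expansion[OF \<Phi> y(1)] window_function_expansion[OF \<Psi> y(2)]
          sum_product
        by (intro sum.cong refl) (use y in \<open>auto simp: E_def indicator_def\<close>)
    qed
    also have "\<dots> = (\<Sum>w\<in>?W. \<Sum>w'\<in>?W. \<Phi> (extend w) * \<Psi> (extend w') * measure M (E d w w'))"
    proof -
      have int: "integrable M (\<lambda>y. \<Phi> (extend w) * \<Psi> (extend w') * indicator (E d w w') y)" for w w'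
        using E by (simp add: integrable_real_indicator emeasure_eq_measure)
      have "integral\<^sup>L M (\<lambda>y. \<Phi> (extend w) * \<Psi> (extend w') * indicator (E d w w') y) =
          \<Phi> (extend w) * \<Psi> (extend w') * measure M (E d w w')" for w w'
        using E[of d w w'] by simp
      then show ?thesis
        using int by (simp add: Bochner_Integration.integral_sum Bochner_Integration.integrable_sum del: integral_mult_right_zero integral_mult_right)
    qed
    finally show ?thesis .
  qed
  moreover have "(\<lambda>d. \<Sum>w\<in>?W. \<Sum>w'\<in>?W. \<Phi> (extend w) * \<Psi> (extend w') * measure M (E d w w'))
     \<longlonglongrightarrow> (\<Sum>w\<in>?W. \<Sum>w'\<in>?W. \<Phi> (extend w) * \<Psi> (extend w') * (measure M (cylinder X w') * measure M (cylinder X w)))"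
    unfolding E_def by (intro tendsto_intros mixing_sets cylinder_sets)
  ultimately show ?thesis
    unfolding window_function_integral[OF \<Phi>] window_function_integral[OF \<Psi>] sum_product
    by (simp add: mult_ac)
qed

text \<open>The sequence used for sets in \<open>measure_shift_image\<close> works for functions as well.\<close>

lemma integral_shift:
  assumes "depends_on_window l \<Phi>"
  shows "integral\<^sup>L M (\<lambda>y. \<Phi> (shift_action (int c) y)) = integral\<^sup>L M \<Phi>"
proof -
  have 1: "(\<lambda>d. integral\<^sup>L M (\<lambda>y. \<Psi> (shift_action (int d) y))) \<longlonglongrightarrow> integral\<^sup>L M \<Psi>"
    if "depends_on_window k \<Psi>" for \<Psi> k
    using window_function_mixing[OF depends_on_window_const[of k 1] that] by (simp add: prob_space)
  have "(\<lambda>d. integral\<^sup>L M (\<lambda>y. \<Phi> (shift_action (int (d + c)) y))) \<longlonglongrightarrow> integral\<^sup>L M \<Phi>"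
    using LIMSEQ_ignore_initial_segment[OF 1[OF assms], of c] .
  moreover have "(\<lambda>d. integral\<^sup>L M (\<lambda>y. \<Phi> (shift_action (int (d + c)) y)))
       \<longlonglongrightarrow> integral\<^sup>L M (\<lambda>y. \<Phi> (shift_action (int c) y))"
    using 1[OF depends_on_window_shift[OF assms, of c]]
    by (simp add: add.commute[of _ "int c"] flip: shift_action_add)
  ultimately show ?thesis using LIMSEQ_unique by blast
qed

lemma window_function_frequency:
  assumes "depends_on_window l \<Phi>"
  shows "(\<lambda>k. (\<Sum>i<h k. \<Phi> (shift_action (int i) x)) / real (h k)) \<longlonglongrightarrow> integral\<^sup>L M \<Phi>"
proof -
  let ?N = "\<lambda>w k. card {i \<in> {0..<int (h k)}. subword x i (i + int (length w)) = w}"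
  have "(\<Sum>i<h k. \<Phi> (shift_action (int i) x)) = (\<Sum>w\<in>binary_words l. \<Phi> (extend w) * ?N w k)" for k
  proof -
    have N: "(\<Sum>i<h k. indicator (cylinder X w) (shift_action (int i) x)) = real (?N w k)" for w
    proof -
      have "(\<Sum>i<h k. indicator (cylinder X w) (shift_action (int i) x)) =
         real (card {i\<in>{..<h k}. shift_action (int i) x \<in> cylinder X w})"
        by (simp add: indicator_def sum.If_cases Int_def)
      also have "card {i\<in>{..<h k}. shift_action (int i) x \<in> cylinder X w} = ?N w k"
      proof (rule bij_betw_same_card[of int])
        have "int ` {i\<in>{..<h k}. shift_action (int i) x \<in> cylinder X w} =
           {i \<in> {0..<int (h k)}. subword x i (i + int (length w)) = w}"
        proof (intro equalityI subsetI)
          fix j assume "j \<in> {i \<in> {0..<int (h k)}. subword x i (i + int (length w)) = w}"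
          then show "j \<in> int ` {i\<in>{..<h k}. shift_action (int i) x \<in> cylinder X w}"
            using x_in shift_in_X
            by (intro image_eqI[of _ _ "nat j"]) (auto simp: cylinder_def subword_shift add.commute)
        qed (auto simp: cylinder_def subword_shift add.commute)
        then show "bij_betw int {i\<in>{..<h k}. shift_action (int i) x \<in> cylinder X w}
            {i \<in> {0..<int (h k)}. subword x i (i + int (length w)) = w}"
          by (simp add: bij_betw_def)
      qed
      finally show ?thesis .
    qed
    have "(\<Sum>i<h k. \<Phi> (shift_action (int i) x)) =
       (\<Sum>i<h k. \<Sum>w\<in>binary_words l. \<Phi> (extend w) * indicator (cylinder X w) (shift_action (int i) x))"
      by (intro sum.cong refl window_function_expansion[OF assms] shift_in_X x_in)
    also have "\<dots> = (\<Sum>w\<in>binary_words l. \<Phi> (extend w) * (\<Sum>i<h k. indicator (cylinder X w) (shift_action (int i) x)))"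
      by (subst sum.swap) (simp add: sum_distrib_left)
    finally show ?thesis by (simp only: N)
  qed
  then have "(\<Sum>i<h k. \<Phi> (shift_action (int i) x)) / real (h k) =
      (\<Sum>w\<in>binary_words l. \<Phi> (extend w) * (?N w k / real (h k)))" for k
    by (simp add: sum_divide_distrib)
  then show ?thesis
    unfolding window_function_integral[OF assms]
    by (simp only:) (intro tendsto_sum tendsto_mult tendsto_const x_generic)
qed

lemma integral_occurs: "integral\<^sup>L M (occurs w) = measure M (cylinder X w)"
proof -
  have "integral\<^sup>L M (occurs w) = integral\<^sup>L M (indicator (cylinder X w))"
    by (rule Bochner_Integration.integral_cong)
      (auto simp: occurs_def space_M cylinder_def indicator_def)
  then show ?thesis using cylinder_sets by simp
qed

lemma h_ge:
  obtains n0 where "\<And>n. n \<ge> n0 \<Longrightarrow> real (h n) \<ge> N"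
proof -
  let ?N = "nat \<lceil>N\<rceil> + 1"
  obtain n0 where "sublist (subword x 0 (int ?N)) (omega q a n0)"
    using x_in unfolding rank_one_subshift_def mem_Collect_eq
    by (metis of_nat_0_less_iff zero_less_Suc Suc_eq_plus1)
  then have "?N \<le> h n0"
    using sublist_length_le by (metis length_subword diff_zero nat_int)
  moreover have "h n0 \<le> h n" if "n \<ge> n0" for n
    using prefix_omega[of q n0 n a] q_pos that by (auto dest: prefix_length_le)
  ultimately have "N \<le> real (h n)" if "n \<ge> n0" for n using that by (meson order_trans real_nat_ceiling_ge le_add1 of_nat_mono)
  then show ?thesis using that by blast
qed

text \<open>The tower over the copies of \<open>\<omega>\<^sub>n\<close> covers a fixed part of the space: all letters 1
  of \<open>\<omega>\<^sub>k\<close> lie in copies of \<open>\<omega>\<^sub>n\<close>, so there are at least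
  (number of ones) / \<open>h n\<close> copies. Each of them contributes the sum over
  \<open>\<omega>\<^sub>n\<close> to the sum of \<open>\<Phi>\<close> over \<open>\<omega>\<^sub>k\<close>, as
  \<open>\<Phi>\<close> is nonnegative; let \<open>k \<rightarrow> \<infinity>\<close>.\<close>

lemma tower_bound:
  assumes loc: "depends_on_window l \<Phi>" and "l > 0" and nn: "\<And>y. \<Phi> y \<ge> 0"
  shows "measure M (cylinder X [1]) * (\<Sum>i | i + l \<le> h n. \<Phi> (shift_action (int i) x))
     \<le> real (h n) * integral\<^sup>L M \<Phi>"
proof -
  let ?I = "{i. i + l \<le> h n}"
  let ?s = "\<lambda>i. shift_action (int i) x"
  let ?T = "\<Sum>i\<in>?I. \<Phi> (?s i)"
  have finI: "finite ?I" by (rule finite_subset[of _ "{..h n}"]) auto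
  have T0: "?T \<ge> 0" by (intro sum_nonneg nn)
  have key: "(\<Sum>i<h k. occurs [1] (?s i)) * ?T \<le> real (h n) * (\<Sum>i<h k. \<Phi> (?s i))" if "k \<ge> n" for k
  proof -
    obtain S where S: "block_starts (omega q a n) (omega q a k) S" using block_starts_omega[OF \<open>k \<ge> n\<close>] by blast
    have S_le: "s + h n \<le> h k" if "s \<in> S" for s using S that by (auto simp: block_starts_def)
    then have finS: "finite S" by (intro finite_subset[of S "{..h k}"]) force+
    have "(\<Sum>i<h k. occurs [1] (?s i)) = real (card {i\<in>{..<h k}. subword (?s i) 0 1 = [1]})"
      by (simp add: occurs_def sum.If_cases Int_def)
    also have "\<dots> \<le> real (card (\<Union>s\<in>S. {s..<s + h n}))"
    proof (intro of_nat_mono card_mono)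
      show "finite (\<Union>s\<in>S. {s..<s + h n})" using finS by blast
      show "{i\<in>{..<h k}. subword (?s i) 0 1 = [1]} \<subseteq> (\<Union>s\<in>S. {s..<s + h n})"
      proof
        fix i assume i: "i \<in> {i\<in>{..<h k}. subword (?s i) 0 1 = [1]}"
        then have "omega q a k ! i \<noteq> 0"
          using x_nth[of i k] by (auto simp: subword_shift subword_def shift_action_def)
        then show "i \<in> (\<Union>s\<in>S. {s..<s + h n})" using S i unfolding block_starts_def by auto
      qed
    qed
    also have "\<dots> \<le> real (\<Sum>s\<in>S. card {s..<s + h n})"
      using card_UN_le[OF finS, of "\<lambda>s. {s..<s + h n}"] by (rule of_nat_mono)
    also have "\<dots> = real (card S) * real (h n)" by simp
    finally have ones: "(\<Sum>i<h k. occurs [1] (?s i)) \<le> real (card S) * real (h n)" .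
    have "real (card S) * ?T = (\<Sum>s\<in>S. \<Sum>i\<in>?I. \<Phi> (?s (s + i)))"
    proof -
      have "\<Phi> (?s (s + i)) = \<Phi> (?s i)" if "s \<in> S" "i \<in> ?I" for s i
      proof (rule depends_on_windowD[OF loc])
        fix j assume "j < l"
        then have *: "i + j < h n" using that by simp
        then have "x (int (s + (i + j))) = x (int (i + j))"
          using x_nth[of "s + (i + j)" k] x_nth[OF *] S_le[OF that(1)] S that(1) unfolding block_starts_def by simp
        then show "?s (s + i) (int j) = ?s i (int j)"
          by (simp add: shift_action_def algebra_simps)
      qed
      then show ?thesis by simp
    qed
    also have "\<dots> = (\<Sum>(s, i)\<in>S \<times> ?I. \<Phi> (?s (s + i)))"
      by (rule sum.cartesian_product)
    also have "\<dots> = (\<Sum>p\<in>(\<lambda>(s, i). s + i) ` (S \<times> ?I). \<Phi> (?s p))"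
    proof (subst sum.reindex)
      show "inj_on (\<lambda>(s, i). s + i) (S \<times> ?I)"
      proof (rule inj_onI, clarsimp)
        fix s i s' i' assume *: "s \<in> S" "s' \<in> S" "i + l \<le> h n" "i' + l \<le> h n" "s + i = s' + i'"
        have "s < s' \<longrightarrow> s + h n \<le> s'" "s' < s \<longrightarrow> s' + h n \<le> s"
          using S *(1,2) unfolding block_starts_def by blast+
        then have "s = s'" using \<open>l > 0\<close> *(3-5) by linarith
        then show "s = s' \<and> i = i'" using *(5) by linarith
      qed
    qed (simp add: comp_def case_prod_beta)
    also have "\<dots> \<le> (\<Sum>p<h k. \<Phi> (?s p))"
    proof (rule sum_mono2)
      show "(\<lambda>(s, i). s + i) ` (S \<times> ?I) \<subseteq> {..<h k}"
      proof clarsimp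
        fix s i assume "s \<in> S" "i + l \<le> h n"
        then show "s + i < h k" using S_le[of s] \<open>l > 0\<close> by linarith
      qed
    qed (simp_all add: nn)
    finally have "real (h n) * (real (card S) * ?T) \<le> real (h n) * (\<Sum>p<h k. \<Phi> (?s p))"
      by (rule mult_left_mono) simp
    moreover have "(\<Sum>i<h k. occurs [1] (?s i)) * ?T \<le> real (card S) * real (h n) * ?T"
      by (rule mult_right_mono[OF ones T0])
    ultimately show ?thesis by (simp add: mult_ac)
  qed
  have "integral\<^sup>L M (occurs [1]) * ?T \<le> real (h n) * integral\<^sup>L M \<Phi>"
  proof (rule LIMSEQ_le)
    show "(\<lambda>k. (\<Sum>i<h k. occurs [1] (?s i)) / real (h k) * ?T) \<longlonglongrightarrow> integral\<^sup>L M (occurs [1]) * ?T"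
      by (intro tendsto_mult tendsto_const window_function_frequency[OF depends_on_window_occurs])
    show "(\<lambda>k. real (h n) * ((\<Sum>i<h k. \<Phi> (?s i)) / real (h k))) \<longlonglongrightarrow> real (h n) * integral\<^sup>L M \<Phi>"
      by (intro tendsto_mult tendsto_const window_function_frequency[OF loc])
    show "\<exists>N. \<forall>k\<ge>N. (\<Sum>i<h k. occurs [1] (?s i)) / real (h k) * ?T
        \<le> real (h n) * ((\<Sum>i<h k. \<Phi> (?s i)) / real (h k))"
      using divide_right_mono[OF key, of _ "real (h _)"] by auto
  qed
  then show ?thesis by (simp add: integral_occurs)
qed

text \<open>A word that occurs once in some \<open>\<omega>\<^sub>n\<close> occurs in every copy of
  \<open>\<omega>\<^sub>n\<close>.\<close>

lemma cylinder_pos: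
  assumes "y \<in> X" "w \<noteq> []" "subword y i (i + int (length w)) = w"
  shows "measure M (cylinder X w) > 0"
proof -
  have "i < i + int (length w)" using assms(2) by simp
  then obtain n where "sublist w (omega q a n)"
    using assms(1,3) unfolding rank_one_subshift_def mem_Collect_eq by metis
  then obtain ps ss where w: "omega q a n = ps @ w @ ss" by (auto simp: sublist_def)
  have "x (int (length ps) + int k) = w ! k" if "k < length w" for k
    using x_nth[of "length ps + k" n] that by (simp add: w nth_append)
  then have "subword x (int (length ps)) (int (length ps) + int (length w)) = w"
    using subword_eq_iff by blast
  then have "1 = occurs w (shift_action (int (length ps)) x)"
    by (simp add: occurs_def subword_shift add.commute)
  also have "\<dots> \<le> (\<Sum>i | i + length w \<le> h n. occurs w (shift_action (int i) x))"
    by (rule member_le_sum) (auto simp: w occurs_def intro!: finite_subset[of _ "{..h n}"])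
  finally have "measure M (cylinder X [1]) * 1 \<le> real (h n) * measure M (cylinder X w)"
    using order_trans[OF mult_left_mono[OF _ measure_nonneg] tower_bound[OF depends_on_window_occurs]]
      assms(2) by (metis integral_occurs length_greater_0_conv occurs_nonneg)
  then have "real (h n) * measure M (cylinder X w) > 0" using one_pos by simp
  then show ?thesis by (simp add: zero_less_mult_iff)
qed

end

section \<open>Self-correlations of a block\<close>

text \<open>Replacing \<open>b i\<close> by the mean of \<open>b\<close> over
  \<open>i, i + D, \<dots>, i + (L - 1) D\<close> changes the sum only at the two ends.\<close>

lemma sum_along_progression:
  fixes b :: "nat \<Rightarrow> real"
  assumes b: "\<And>i. \<bar>b i\<bar> \<le> 1" and "L > 0"
  shows "\<bar>\<Sum>i<p. b i\<bar> \<le> real (L * D) + (\<Sum>i<p - L * D. \<bar>(\<Sum>j<L. b (i + j * D)) / real L\<bar>)"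
proof -
  let ?p = "p - L * D"
  have *: "\<bar>(\<Sum>i<p. b i) - (\<Sum>i<?p. b (i + j * D))\<bar> \<le> real (L * D)" if "j < L" for j
  proof -
    let ?I = "{0 + j * D..<?p + j * D}"
    have "j * D \<le> L * D" using that by simp
    then have "?p + j * D \<le> p \<or> ?p = 0" by linarith
    then have sub: "?I \<subseteq> {..<p}" by auto
    have "(\<Sum>i<?p. b (i + j * D)) = sum b ?I"
      by (simp only: sum.shift_bounds_nat_ivl atLeast0LessThan)
    then have "(\<Sum>i<p. b i) - (\<Sum>i<?p. b (i + j * D)) = sum b ({..<p} - ?I)"
      using sub by (simp add: sum_diff)
    also have "\<bar>\<dots>\<bar> \<le> (\<Sum>i\<in>{..<p} - ?I. 1)"
      by (rule order_trans[OF sum_abs sum_mono]) (rule b)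
    also have "\<dots> = real (p - ?p)" using sub by (simp add: card_Diff_subset)
    also have "\<dots> \<le> real (L * D)" by linarith
    finally show ?thesis .
  qed
  have "real L * (\<Sum>i<p. b i) - (\<Sum>j<L. \<Sum>i<?p. b (i + j * D)) =
      (\<Sum>j<L. (\<Sum>i<p. b i) - (\<Sum>i<?p. b (i + j * D)))"
    by (simp add: sum_subtractf)
  also have "\<bar>\<dots>\<bar> \<le> (\<Sum>j<L. real (L * D))"
    by (rule order_trans[OF sum_abs sum_mono]) (use * in auto)
  finally have "\<bar>real L * (\<Sum>i<p. b i) - (\<Sum>j<L. \<Sum>i<?p. b (i + j * D))\<bar> \<le> real L * real (L * D)"
    by simp
  moreover have "(\<Sum>j<L. \<Sum>i<?p. b (i + j * D)) = real L * (\<Sum>i<?p. (\<Sum>j<L. b (i + j * D)) / real L)"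
    using \<open>L > 0\<close> by (subst sum.swap) (simp flip: sum_divide_distrib)
  ultimately have "\<bar>real L * ((\<Sum>i<p. b i) - (\<Sum>i<?p. (\<Sum>j<L. b (i + j * D)) / real L))\<bar> \<le> real L * real (L * D)"
    by (simp add: right_diff_distrib)
  then have "\<bar>(\<Sum>i<p. b i) - (\<Sum>i<?p. (\<Sum>j<L. b (i + j * D)) / real L)\<bar> \<le> real (L * D)"
    using \<open>L > 0\<close> by (simp add: abs_mult)
  then show ?thesis using sum_abs[of "\<lambda>i. (\<Sum>j<L. b (i + j * D)) / real L" "{..<?p}"] by linarith
qed

lemma integral_double_sum:
  fixes F :: "'i \<Rightarrow> 'j \<Rightarrow> 'a \<Rightarrow> real"
  assumes "\<And>i j. i \<in> I \<Longrightarrow> j \<in> J \<Longrightarrow> integrable M (F i j)"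
  shows "integral\<^sup>L M (\<lambda>y. \<Sum>i\<in>I. \<Sum>j\<in>J. F i j y) = (\<Sum>i\<in>I. \<Sum>j\<in>J. integral\<^sup>L M (F i j))"
proof -
  have "integral\<^sup>L M (\<lambda>y. \<Sum>i\<in>I. \<Sum>j\<in>J. F i j y) = (\<Sum>i\<in>I. integral\<^sup>L M (\<lambda>y. \<Sum>j\<in>J. F i j y))"
    by (intro Bochner_Integration.integral_sum Bochner_Integration.integrable_sum assms)
  also have "\<dots> = (\<Sum>i\<in>I. \<Sum>j\<in>J. integral\<^sup>L M (F i j))"
    by (intro sum.cong refl Bochner_Integration.integral_sum assms)
  finally show ?thesis .
qed

context mixing_rank_one
begin

definition centred :: "nat list \<Rightarrow> (int \<Rightarrow> nat) \<Rightarrow> real" where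
  "centred w y = occurs w y - measure M (cylinder X w)"

lemma abs_centred_le: "\<bar>centred w y\<bar> \<le> 1"
  using prob_le_1[of "cylinder X w"] measure_nonneg[of M "cylinder X w"]
  by (auto simp: centred_def occurs_def)

lemma depends_on_window_centred: "depends_on_window (length w) (centred w)"
  unfolding centred_def
  using depends_on_window_compose2[OF depends_on_window_occurs depends_on_window_const, where F = "(-)"] by simp

lemma integral_centred: "integral\<^sup>L M (centred w) = 0"
  unfolding centred_def
  using window_function_integrable[OF depends_on_window_occurs, of w]
  by (simp add: integral_occurs prob_space)

text \<open>With \<open>f = centred w\<close>, \<open>g d = f \<cdot> f \<circ> \<sigma>\<^sup>d\<close> and
  \<open>G d\<close> the mean of \<open>L\<close> translates of \<open>g d\<close> by multiples of
  \<open>D1\<close>, the integral of \<open>(G d)\<^sup>2\<close> tends for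
  \<open>d \<rightarrow> \<infinity>\<close> to the mean over \<open>j, j' < L\<close> of
  \<open>(\<integral> f \<circ> \<sigma>\<^bsup>j D1\<^esup> \<cdot> f \<circ> \<sigma>\<^bsup>j' D1\<^esup>)\<^sup>2\<close>.
  If \<open>D1\<close> is large, only the diagonal terms matter, and the mean is of order \<open>1/L\<close>.
  The tower bound turns this into a bound inside \<open>\<omega>\<^sub>n\<close> that is uniform in
  \<open>n\<close> and in \<open>d\<close>, also when \<open>d\<close> is comparable to \<open>h n\<close>.\<close>

lemma correlation_small:
  assumes "w \<noteq> []" "\<epsilon> > 0"
  obtains D n0 where "D > 0" "\<And>n d. n \<ge> n0 \<Longrightarrow> d \<ge> D \<Longrightarrow>
     \<bar>\<Sum>i | i + d + length w \<le> h n. centred w (shift_action (int i) x) * centred w (shift_action (int (i + d)) x)\<bar>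
       \<le> \<epsilon> * real (h n)"
proof -
  let ?f = "centred w" and ?l = "length w" and ?\<kappa> = "measure M (cylinder X [1])"
  let ?sh = "\<lambda>i. shift_action (int i)"
  have f_shift: "depends_on_window (?l + d) (\<lambda>y. ?f (?sh d y))" for d
    by (rule depends_on_window_shift[OF depends_on_window_centred])
  have f_loc: "depends_on_window (?l + d) ?f" for d
    by (rule depends_on_window_mono[OF depends_on_window_centred]) simp
  define g where "g d y = ?f y * ?f (?sh d y)" for d y
  have g_loc: "depends_on_window (?l + d) (g d)" for d
    unfolding g_def using depends_on_window_compose2[OF f_loc f_shift, where F = "(*)"] .
  have g_le: "\<bar>g d y\<bar> \<le> 1" for d y
    by (simp add: g_def abs_mult mult_le_one abs_centred_le)
  \<comment> \<open>Chosen such that \<open>3 / (\<kappa> L \<theta>) \<le> \<theta>\<close> below, with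
    \<open>\<theta> = \<epsilon> / 3\<close>.\<close>
  define L where "L = nat \<lceil>27 / (\<epsilon>\<^sup>2 * ?\<kappa>)\<rceil> + 1"
  have L: "L > 0" "27 / (\<epsilon>\<^sup>2 * ?\<kappa>) \<le> real L" unfolding L_def by linarith+
  have "(\<lambda>d. integral\<^sup>L M (g d)) \<longlonglongrightarrow> 0"
    using window_function_mixing[OF depends_on_window_centred depends_on_window_centred, of w]
    by (simp add: integral_centred g_def[abs_def])
  then obtain D0 where D0: "\<And>d. d \<ge> D0 \<Longrightarrow> \<bar>integral\<^sup>L M (g d)\<bar> < 1 / real L"
    using L(1) LIMSEQ_D[of "\<lambda>d. integral\<^sup>L M (g d)" 0 "1 / real L"] by auto
  define D1 where "D1 = D0 + 1"
  define \<phi> where "\<phi> j j' y = ?f (?sh (j * D1) y) * ?f (?sh (j' * D1) y)" for j j' y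
  have \<phi>_loc: "depends_on_window (?l + L * D1) (\<phi> j j')" if "j < L" "j' < L" for j j'
  proof -
    have "j * D1 \<le> L * D1" "j' * D1 \<le> L * D1" using that by simp_all
    then have "depends_on_window (?l + L * D1) (\<lambda>y. ?f (?sh (j * D1) y))"
      "depends_on_window (?l + L * D1) (\<lambda>y. ?f (?sh (j' * D1) y))"
      by - (rule depends_on_window_mono[OF f_shift], simp)+
    from depends_on_window_compose2[OF this, where F = "(*)"] show ?thesis unfolding \<phi>_def .
  qed
  have \<phi>_le: "\<bar>\<phi> j j' y\<bar> \<le> 1" for j j' y
    by (simp add: \<phi>_def abs_mult mult_le_one abs_centred_le)
  have \<phi>_int_lt: "\<bar>integral\<^sup>L M (\<phi> j j')\<bar> \<le> 1 / real L" if "j < j'" for j j'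
  proof -
    \<comment> \<open>By invariance only the difference of the two displacements counts.\<close>
    have "\<phi> j j' = (\<lambda>y. g ((j' - j) * D1) (?sh (j * D1) y))"
    proof
      fix y
      have "(j' - j) * D1 + j * D1 = j' * D1" using that by (simp add: add_mult_distrib[symmetric])
      then have "int ((j' - j) * D1) + int (j * D1) = int (j' * D1)" by (metis of_nat_add)
      then show "\<phi> j j' y = g ((j' - j) * D1) (?sh (j * D1) y)"
        by (simp only: \<phi>_def g_def flip: shift_action_add)
    qed
    then have "integral\<^sup>L M (\<phi> j j') = integral\<^sup>L M (g ((j' - j) * D1))"
      by (simp only: integral_shift[OF g_loc])
    moreover have "(j' - j) * D1 \<ge> D0"
    proof -
      have "D0 \<le> 1 * D1" by (simp add: D1_def)
      also have "\<dots> \<le> (j' - j) * D1" using that by (intro mult_le_mono1) simp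
      finally show ?thesis .
    qed
    ultimately show ?thesis using D0 by (metis less_imp_le)
  qed
  have \<phi>_int: "(integral\<^sup>L M (\<phi> j j'))\<^sup>2 \<le> (if j = j' then 1 else 1 / real L)" if "j < L" "j' < L" for j j'
  proof (cases "j = j'")
    case True
    have "\<bar>integral\<^sup>L M (\<phi> j j')\<bar> \<le> integral\<^sup>L M (\<lambda>y. \<bar>\<phi> j j' y\<bar>)"
      by (rule integral_abs_bound)
    also have "\<dots> \<le> integral\<^sup>L M (\<lambda>y. 1)"
      using window_function_integrable[OF \<phi>_loc[OF that]] \<phi>_le
      by (intro integral_mono) auto
    finally have "\<bar>integral\<^sup>L M (\<phi> j j')\<bar> \<le> 1" by (simp add: prob_space)
    then show ?thesis using True by (simp add: abs_square_le_1)
  next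
    case False
    have sym: "\<phi> j j' = \<phi> j' j" for j j' by (rule ext) (simp only: \<phi>_def mult.commute)
    have "\<bar>integral\<^sup>L M (\<phi> j j')\<bar> \<le> 1 / real L"
      using False \<phi>_int_lt[of j j'] \<phi>_int_lt[of j' j] sym[of j j'] by (cases "j < j'") auto
    then have "(integral\<^sup>L M (\<phi> j j'))\<^sup>2 \<le> (1 / real L)\<^sup>2" by (metis abs_ge_zero power2_abs power_mono)
    also have "\<dots> \<le> 1 / real L" using L(1) by (simp add: power2_eq_square divide_simps)
    finally show ?thesis using False by simp
  qed
  define G where "G d y = (\<Sum>j<L. g d (?sh (j * D1) y)) / real L" for d y
  have G_loc: "depends_on_window (?l + d + L * D1) (G d)" for d
  proof -
    have "depends_on_window (?l + d + L * D1) (\<lambda>y. \<Sum>j<L. g d (?sh (j * D1) y))"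
    proof (rule depends_on_window_sum)
      fix j assume "j \<in> {..<L}"
      then show "depends_on_window (?l + d + L * D1) (\<lambda>y. g d (?sh (j * D1) y))"
        by (intro depends_on_window_mono[OF depends_on_window_shift[OF g_loc]]) simp
    qed
    from depends_on_window_compose2[OF this this, where F = "\<lambda>u _. u / real L"] show ?thesis
      unfolding G_def .
  qed
  have G2: "(G d y)\<^sup>2 = (\<Sum>j<L. \<Sum>j'<L. \<phi> j j' y * \<phi> j j' (?sh d y)) / (real L)\<^sup>2" for d y
  proof -
    have "g d (?sh (j * D1) y) * g d (?sh (j' * D1) y) = \<phi> j j' y * \<phi> j j' (?sh d y)" for j j'
      unfolding g_def \<phi>_def by (simp add: mult_ac add.commute flip: shift_action_add)
    then show ?thesis unfolding G_def power_divide by (simp add: power2_eq_square sum_product)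
  qed
  have "(\<lambda>d. integral\<^sup>L M (\<lambda>y. (G d y)\<^sup>2)) \<longlonglongrightarrow>
      (\<Sum>j<L. \<Sum>j'<L. integral\<^sup>L M (\<phi> j j') * integral\<^sup>L M (\<phi> j j')) / (real L)\<^sup>2"
  proof -
    have int: "integrable M (\<lambda>y. \<phi> j j' y * \<phi> j j' (?sh d y))" if "j < L" "j' < L" for j j' d
      using window_function_integrable[OF depends_on_window_compose2[OF
          depends_on_window_mono[OF \<phi>_loc[OF that]] depends_on_window_shift[OF \<phi>_loc[OF that], of d], where F = "(*)"]]
      by simp
    have "integral\<^sup>L M (\<lambda>y. (G d y)\<^sup>2) =
       (\<Sum>j<L. \<Sum>j'<L. integral\<^sup>L M (\<lambda>y. \<phi> j j' y * \<phi> j j' (?sh d y))) / (real L)\<^sup>2" for d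
      unfolding G2 integral_divide_zero
      by (subst integral_double_sum) (use int in auto)
    then show ?thesis
      by (simp only:) (use L in \<open>auto intro!: tendsto_divide tendsto_sum window_function_mixing[OF \<phi>_loc \<phi>_loc]\<close>)
  qed
  moreover have "(\<Sum>j<L. \<Sum>j'<L. integral\<^sup>L M (\<phi> j j') * integral\<^sup>L M (\<phi> j j')) / (real L)\<^sup>2 < 3 / real L"
  proof -
    have "(\<Sum>j<L. \<Sum>j'<L. integral\<^sup>L M (\<phi> j j') * integral\<^sup>L M (\<phi> j j'))
       \<le> (\<Sum>j<L. \<Sum>j'<L. (if j = j' then 1 else 0) + 1 / real L)"
    proof (intro sum_mono)
      fix j j' assume "j \<in> {..<L}" "j' \<in> {..<L}"
      then show "integral\<^sup>L M (\<phi> j j') * integral\<^sup>L M (\<phi> j j') \<le> (if j = j' then 1 else 0) + 1 / real L"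
        using \<phi>_int[of j j'] by (auto simp: power2_eq_square split: if_splits intro: add_increasing2)
    qed
    also have "\<dots> = 2 * real L" using L(1) by (simp add: sum.distrib)
    also have "\<dots> < 3 * real L" using L(1) by simp
    finally show ?thesis using L(1) by (simp add: power2_eq_square divide_simps)
  qed
  ultimately have "\<forall>\<^sub>F d in sequentially. integral\<^sup>L M (\<lambda>y. (G d y)\<^sup>2) < 3 / real L"
    by (rule order_tendstoD)
  then obtain D2 where D2: "\<And>d. d \<ge> D2 \<Longrightarrow> integral\<^sup>L M (\<lambda>y. (G d y)\<^sup>2) < 3 / real L"
    by (auto simp: eventually_sequentially)
  obtain n0 where n0: "\<And>n. n \<ge> n0 \<Longrightarrow> 3 * real (L * D1) / \<epsilon> \<le> real (h n)"
    using h_ge by blast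
  show thesis
  proof (rule that[of "D2 + 1" n0])
    fix n d assume "n \<ge> n0" and d: "D2 + 1 \<le> d"
    define p where "p = Suc (h n) - (d + ?l)"
    have I: "{i. i + d + ?l \<le> h n} = {..<p}" and I': "{i. i + (?l + d + L * D1) \<le> h n} = {..<p - L * D1}"
      by (auto simp: p_def)
    have "?\<kappa> * (\<Sum>i<p - L * D1. (G d (?sh i x))\<^sup>2) \<le> real (h n) * integral\<^sup>L M (\<lambda>y. (G d y)\<^sup>2)"
      using tower_bound[of "?l + d + L * D1" "\<lambda>y. (G d y)\<^sup>2" n] \<open>w \<noteq> []\<close>
        depends_on_window_compose2[OF G_loc[of d] G_loc[of d], where F = "\<lambda>u _. u\<^sup>2"] by (simp only: I') simp
    also have "\<dots> \<le> real (h n) * (3 / real L)"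
      using D2[of d] d by (intro mult_left_mono) auto
    finally have sum_G2: "(\<Sum>i<p - L * D1. (G d (?sh i x))\<^sup>2) \<le> real (h n) * (3 / real L) / ?\<kappa>"
      by (simp only: pos_le_divide_eq[OF one_pos] mult.commute[of _ ?\<kappa>])
    define \<theta> where "\<theta> = \<epsilon> / 3"
    have "\<theta> > 0" using \<open>\<epsilon> > 0\<close> by (simp add: \<theta>_def)
    \<comment> \<open>Replaces the Cauchy-Schwarz inequality in passing from \<open>G\<^sup>2\<close> to
      \<open>\<bar>G\<bar>\<close>.\<close>
    have amgm: "\<bar>G d y\<bar> \<le> \<theta> + (G d y)\<^sup>2 / \<theta>" for y
    proof (cases "\<bar>G d y\<bar> \<le> \<theta>")
      case True
      then show ?thesis using \<open>\<theta> > 0\<close> by (simp add: add_increasing2)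
    next
      case False
      then have "\<theta> * \<bar>G d y\<bar> \<le> \<bar>G d y\<bar> * \<bar>G d y\<bar>" by (intro mult_right_mono) auto
      then have "\<bar>G d y\<bar> \<le> (G d y)\<^sup>2 / \<theta>" using \<open>\<theta> > 0\<close> by (simp add: power2_eq_square pos_le_divide_eq mult.commute)
      then show ?thesis using \<open>\<theta> > 0\<close> by linarith
    qed
    have "\<bar>\<Sum>i<p. g d (?sh i x)\<bar> \<le> real (L * D1) + (\<Sum>i<p - L * D1. \<bar>G d (?sh i x)\<bar>)"
    proof -
      have "(\<Sum>j<L. g d (?sh (i + j * D1) x)) / real L = G d (?sh i x)" for i
        by (simp add: G_def add.commute flip: shift_action_add)
      then show ?thesis
        using sum_along_progression[of "\<lambda>i. g d (?sh i x)" L p D1] g_le L(1) by simp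
    qed
    also have "(\<Sum>i<p - L * D1. \<bar>G d (?sh i x)\<bar>) \<le> (\<Sum>i<p - L * D1. \<theta> + (G d (?sh i x))\<^sup>2 / \<theta>)"
      by (intro sum_mono amgm)
    also have "\<dots> = real (p - L * D1) * \<theta> + (\<Sum>i<p - L * D1. (G d (?sh i x))\<^sup>2) / \<theta>"
      by (simp add: sum.distrib sum_divide_distrib)
    also have "\<dots> \<le> real (h n) * \<theta> + real (h n) * (3 / real L) / ?\<kappa> / \<theta>"
      using \<open>\<theta> > 0\<close> sum_G2 d by (intro add_mono mult_right_mono divide_right_mono) (auto simp: p_def)
    also have "real (h n) * (3 / real L) / ?\<kappa> / \<theta> \<le> real (h n) * \<theta>"
    proof -
      have "27 \<le> real L * (\<epsilon>\<^sup>2 * ?\<kappa>)" using L(2) \<open>\<epsilon> > 0\<close> one_pos by (simp add: pos_divide_le_eq)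
      then have "3 / real L / ?\<kappa> / \<theta> \<le> \<theta>"
        using L(1) one_pos \<open>\<epsilon> > 0\<close> by (simp add: \<theta>_def divide_simps power2_eq_square mult_ac)
      from mult_left_mono[OF this, of "real (h n)"] show ?thesis by simp
    qed
    also have "real (L * D1) + (real (h n) * \<theta> + real (h n) * \<theta>) \<le> \<epsilon> * real (h n)"
      using n0[OF \<open>n \<ge> n0\<close>] \<open>\<epsilon> > 0\<close> by (simp add: \<theta>_def divide_simps mult_ac)
    finally have "\<bar>\<Sum>i<p. g d (?sh i x)\<bar> \<le> \<epsilon> * real (h n)" by simp
    moreover have "g d (?sh i x) = ?f (?sh i x) * ?f (?sh (i + d) x)" for i
      by (simp add: g_def add.commute flip: shift_action_add)
    ultimately show "\<bar>\<Sum>i | i + d + ?l \<le> h n. ?f (?sh i x) * ?f (?sh (i + d) x)\<bar> \<le> \<epsilon> * real (h n)"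
      unfolding I by simp
  qed simp
qed

end

section \<open>Occurrences of a word in many displaced copies of a block\<close>

lemma card_close_le:
  fixes S :: "int set" assumes "finite S" shows "card {s'\<in>S. \<bar>s' - s\<bar> < int D} \<le> 2 * D"
proof -
  have "card {s'\<in>S. \<bar>s' - s\<bar> < int D} \<le> card {s - int D <..< s + int D}"
    by (intro card_mono) auto
  also have "\<dots> \<le> 2 * D" by simp
  finally show ?thesis .
qed

context mixing_rank_one
begin

text \<open>\<open>S\<close> consists of the starts of copies of \<open>\<omega>\<^sub>n\<close>, and at the times in
  \<open>V\<close> none of these copies shows \<open>w\<close>. The sum over \<open>S\<close> of the centred
  indicators of \<open>w\<close> then equals \<open>- u |S|\<close> on \<open>V\<close>. Its square summed
  over all times is the sum of the correlations of all pairs of copies, where at most \<open>2 D |S|\<close>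
  pairs are close together and the others are almost uncorrelated.\<close>

lemma common_gaps_few:
  fixes S V :: "int set"
  assumes "w \<noteq> []" "D > 0" "\<epsilon> > 0" "finite S" "finite V"
    and corr: "\<And>d. d \<ge> D \<Longrightarrow>
     \<bar>\<Sum>i | i + d + length w \<le> h n. centred w (shift_action (int i) x) * centred w (shift_action (int (i + d)) x)\<bar>
       \<le> \<epsilon> * real (h n)"
    and gap: "\<And>t s. t \<in> V \<Longrightarrow> s \<in> S \<Longrightarrow> 0 \<le> t - s \<and> t - s + int (length w) \<le> int (h n) \<and>
       occurs w (shift_action (t - s) x) = 0"
  shows "real (card V) * (measure M (cylinder X w))\<^sup>2 * real (card S) \<le> (2 * real D + \<epsilon> * real (card S)) * real (h n)"
proof (cases "S = {}")
  case True
  then show ?thesis by simp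
next
  case False
  let ?u = "measure M (cylinder X w)" and ?H = "int (h n)"
  \<comment> \<open>Extended by zero, so that all pairs of copies can be summed over the same set \<open>T\<close> of
    times.\<close>
  define e where "e i = (if 0 \<le> i \<and> i + int (length w) \<le> ?H then centred w (shift_action i x) else 0)" for i
  define T where "T = V \<union> (\<Union>s\<in>S. {s..s + ?H})"
  have finT: "finite T" using assms(4,5) by (simp add: T_def)
  define c where "c s s' = (\<Sum>t\<in>T. e (t - s) * e (t - s'))" for s s'
  have c_sym: "c s s' = c s' s" for s s' by (simp add: c_def mult.commute)
  have c_eq: "c s s' = (\<Sum>i | i + d + length w \<le> h n.
      centred w (shift_action (int i) x) * centred w (shift_action (int (i + d)) x))"
    if "s \<in> S" "s' \<in> S" "s' = s + int d" for s s' d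
  proof -
    let ?I = "{i. i + d + length w \<le> h n}"
    have inj: "inj_on (\<lambda>i. s' + int i) ?I" by (simp add: inj_on_def)
    have "c s s' = (\<Sum>t\<in>(\<lambda>i. s' + int i) ` ?I. e (t - s) * e (t - s'))"
      unfolding c_def
    proof (rule sum.mono_neutral_right[OF finT])
      show "(\<lambda>i. s' + int i) ` ?I \<subseteq> T" using that(2) by (auto simp: T_def intro!: bexI[of _ s'])
      show "\<forall>t\<in>T - (\<lambda>i. s' + int i) ` ?I. e (t - s) * e (t - s') = 0"
      proof
        fix t assume t: "t \<in> T - (\<lambda>i. s' + int i) ` ?I"
        have "\<not> (0 \<le> t - s' \<and> t - s + int (length w) \<le> ?H)"
        proof
          assume *: "0 \<le> t - s' \<and> t - s + int (length w) \<le> ?H"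
          then have "nat (t - s') \<in> ?I" "t = s' + int (nat (t - s'))" using that(3) by auto
          then show False using t by blast
        qed
        then show "e (t - s) * e (t - s') = 0" by (auto simp: e_def)
      qed
    qed
    also have "\<dots> = (\<Sum>i\<in>?I. e (s' + int i - s) * e (int i))"
      by (subst sum.reindex[OF inj]) simp
    also have "\<dots> = (\<Sum>i\<in>?I. centred w (shift_action (int i) x) * centred w (shift_action (int (i + d)) x))"
    proof (rule sum.cong[OF refl])
      fix i assume "i \<in> ?I"
      moreover have eq: "s' + int i - s = int (i + d)" using that(3) by simp
      ultimately show "e (s' + int i - s) * e (int i) =
          centred w (shift_action (int i) x) * centred w (shift_action (int (i + d)) x)"
        unfolding eq by (simp add: e_def)
    qed
    finally show ?thesis .
  qed
  have c_le: "c s s' \<le> (if \<bar>s' - s\<bar> < int D then real (h n) else 0) + \<epsilon> * real (h n)" if S: "s \<in> S" "s' \<in> S" for s s'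
  proof -
    have *: "c s s' \<le> (if \<bar>s' - s\<bar> < int D then real (h n) else 0) + \<epsilon> * real (h n)"
      if "s \<in> S" "s' \<in> S" "s \<le> s'" for s s'
    proof -
      define d where "d = nat (s' - s)"
      have d: "s' = s + int d" using that(3) by (simp add: d_def)
      show ?thesis
      proof (cases "d < D")
        case True
        have "c s s' \<le> (\<Sum>i | i + d + length w \<le> h n. 1)"
          unfolding c_eq[OF that(1,2) d]
        proof (rule sum_mono)
          fix i show "centred w (shift_action (int i) x) * centred w (shift_action (int (i + d)) x) \<le> 1"
            using abs_centred_le[of w "shift_action (int i) x"] abs_centred_le[of w "shift_action (int (i + d)) x"]
            by (metis abs_ge_zero abs_le_D1 abs_mult mult_le_one)
        qed
        also have "\<dots> = real (card {i. i + d + length w \<le> h n})" by simp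
        also have "\<dots> \<le> real (card {..<h n})"
        proof (intro of_nat_mono card_mono subsetI)
          fix i assume "i \<in> {i. i + d + length w \<le> h n}"
          moreover have "length w > 0" using \<open>w \<noteq> []\<close> by simp
          ultimately show "i \<in> {..<h n}" by (simp del: length_greater_0_conv)
        qed simp
        finally show ?thesis using True d \<open>\<epsilon> > 0\<close> by (simp add: add_increasing2)
      next
        case False
        then show ?thesis using corr[of d] c_eq[OF that(1,2) d] d by auto
      qed
    qed
    show ?thesis
    proof (cases "s \<le> s'")
      case False
      then show ?thesis using *[of s' s] S c_sym[of s s'] by (simp add: abs_minus_commute)
    qed (use * S in blast)
  qed
  have "real (card V) * (real (card S) * ?u)\<^sup>2 = (\<Sum>t\<in>V. (\<Sum>s\<in>S. e (t - s))\<^sup>2)"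
  proof -
    have "(\<Sum>s\<in>S. e (t - s)) = - (real (card S) * ?u)" if "t \<in> V" for t
    proof -
      have "e (t - s) = - ?u" if "s \<in> S" for s
        using gap[OF \<open>t \<in> V\<close> that] by (simp add: e_def centred_def)
      then show ?thesis by simp
    qed
    then show ?thesis by simp
  qed
  also have "\<dots> \<le> (\<Sum>t\<in>T. (\<Sum>s\<in>S. e (t - s))\<^sup>2)"
    by (rule sum_mono2[OF finT]) (auto simp: T_def)
  also have "\<dots> = (\<Sum>s\<in>S. \<Sum>s'\<in>S. c s s')"
    unfolding c_def power2_eq_square sum_product
    by (subst sum.swap, rule sum.cong[OF refl], rule sum.swap)
  also have "\<dots> \<le> (\<Sum>s\<in>S. \<Sum>s'\<in>S. (if \<bar>s' - s\<bar> < int D then real (h n) else 0) + \<epsilon> * real (h n))"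
    by (intro sum_mono c_le)
  also have "\<dots> = (\<Sum>s\<in>S. real (card {s'\<in>S. \<bar>s' - s\<bar> < int D}) * real (h n) + real (card S) * (\<epsilon> * real (h n)))"
    using assms(4) by (intro sum.cong refl) (simp add: sum.distrib sum.If_cases Int_def)
  also have "\<dots> \<le> (\<Sum>s\<in>S. real (2 * D) * real (h n) + real (card S) * (\<epsilon> * real (h n)))"
    using card_close_le[OF assms(4)] by (intro sum_mono add_right_mono mult_right_mono of_nat_mono) auto
  also have "\<dots> = real (card S) * ((2 * real D + \<epsilon> * real (card S)) * real (h n))"
    by (simp add: algebra_simps)
  finally have "real (card S) * (real (card V) * ?u\<^sup>2 * real (card S))
     \<le> real (card S) * ((2 * real D + \<epsilon> * real (card S)) * real (h n))"
    by (simp add: power2_eq_square mult_ac)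
  moreover have "real (card S) > 0" using False assms(4) by (simp add: card_gt_0_iff)
  ultimately show ?thesis by (simp only: mult_le_cancel_left_pos)
qed

end

section \<open>Times at which a compact set misses a word\<close>

text \<open>\<open>SS\<close> stands for the starts of the blocks, of length \<open>H\<close>. A start \<open>s\<close> in
  \<open>(t - H + 2 e, t - e)\<close> means that the block reaches from \<open>t - e\<close> to beyond
  \<open>t + 2 e\<close>. Since \<open>3 Q\<close> blocks come near \<open>t\<close> and fewer than
  \<open>Q\<close> cover its surroundings, at least \<open>Q\<close> of them start near \<open>t\<close>
  (\<open>t \<in> A\<close>) or end near \<open>t\<close> (\<open>t \<in> B\<close>). After the first time in
  \<open>A\<close>, the \<open>Q\<close> blocks that start there make all later times at distance between
  \<open>3 e\<close> and \<open>H - 3 e\<close> rich, so \<open>A\<close> lies in two short intervals;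
  symmetrically for the last time in \<open>B\<close>.\<close>

lemma poor_times_few:
  fixes SS V :: "int set"
  assumes e: "e \<ge> 0" and V: "V \<subseteq> {0..<H}" "finite SS"
    and wide: "\<And>t. t \<in> V \<Longrightarrow> card (SS \<inter> {t - H - e..t + e}) \<ge> 3 * Q"
    and poor: "\<And>t. t \<in> V \<Longrightarrow> card (SS \<inter> {t - H + 2 * e<..<t - e}) < Q"
  shows "card V \<le> nat (12 * e + 2)"
proof -
  let ?R = "\<lambda>t. SS \<inter> {t - H + 2 * e<..<t - e}"
  define A where "A = {t\<in>V. card (SS \<inter> {t - e..t + e}) \<ge> Q}"
  define B where "B = {t\<in>V. card (SS \<inter> {t - H - e..t - H + 2 * e}) \<ge> Q}"
  have "V \<subseteq> A \<union> B"
  proof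
    fix t assume t: "t \<in> V"
    have "SS \<inter> {t - H - e..t + e} \<subseteq>
       (SS \<inter> {t - H - e..t - H + 2 * e}) \<union> (?R t \<union> (SS \<inter> {t - e..t + e}))" by auto
    then have "card (SS \<inter> {t - H - e..t + e}) \<le>
       card ((SS \<inter> {t - H - e..t - H + 2 * e}) \<union> (?R t \<union> (SS \<inter> {t - e..t + e})))"
      using V(2) by (intro card_mono) auto
    also have "\<dots> \<le> card (SS \<inter> {t - H - e..t - H + 2 * e}) + (card (?R t) + card (SS \<inter> {t - e..t + e}))"
      by (rule order_trans[OF card_Un_le add_left_mono[OF card_Un_le]])
    finally show "t \<in> A \<union> B" using wide[OF t] poor[OF t] t by (auto simp: A_def B_def)
  qed
  have not_both: False if "t \<in> V" "card (SS \<inter> I) \<ge> Q" "I \<subseteq> {t - H + 2 * e<..<t - e}" for t I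
    using poor[OF that(1)] that(2) card_mono[of "?R t" "SS \<inter> I"] V(2) that(3) by fastforce
  have fin: "finite V" using V(1) finite_subset by blast
  have cardA: "card A \<le> nat (6 * e + 1)"
  proof (cases "A = {}")
    case False
    have finA: "finite A" using fin by (simp add: A_def)
    define t0 where "t0 = Min A"
    have t0: "t0 \<in> A" "\<And>t. t \<in> A \<Longrightarrow> t0 \<le> t" using finA False by (auto simp: t0_def)
    then have "t0 \<ge> 0" using V(1) by (auto simp: A_def)
    have "A \<subseteq> {t0..t0 + 3 * e} \<union> {t0 + H - 3 * e..<t0 + H}"
    proof
      fix t assume t: "t \<in> A"
      then have "t \<in> V" "t < H" using V(1) by (auto simp: A_def)
      show "t \<in> {t0..t0 + 3 * e} \<union> {t0 + H - 3 * e..<t0 + H}"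
      proof (rule ccontr)
        assume "t \<notin> {t0..t0 + 3 * e} \<union> {t0 + H - 3 * e..<t0 + H}"
        then have "{t0 - e..t0 + e} \<subseteq> {t - H + 2 * e<..<t - e}"
          using t0(2)[OF t] \<open>t < H\<close> \<open>t0 \<ge> 0\<close> e by auto
        then show False using not_both[OF \<open>t \<in> V\<close>] t0(1) by (auto simp: A_def)
      qed
    qed
    then have "card A \<le> card ({t0..t0 + 3 * e} \<union> {t0 + H - 3 * e..<t0 + H})"
      by (intro card_mono) auto
    also have "\<dots> \<le> card {t0..t0 + 3 * e} + card {t0 + H - 3 * e..<t0 + H}" by (rule card_Un_le)
    also have "\<dots> = nat (6 * e + 1)" using e by simp
    finally show ?thesis .
  qed (use e in simp)
  have cardB: "card B \<le> nat (6 * e + 1)"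
  proof (cases "B = {}")
    case False
    have finB: "finite B" using fin by (simp add: B_def)
    define t0 where "t0 = Max B"
    have t0: "t0 \<in> B" "\<And>t. t \<in> B \<Longrightarrow> t \<le> t0" using finB False by (auto simp: t0_def)
    then have "t0 < H" using V(1) by (auto simp: B_def)
    have "B \<subseteq> {t0 - 3 * e..t0} \<union> {t0 - H<..t0 - H + 3 * e}"
    proof
      fix t assume t: "t \<in> B"
      then have "t \<in> V" "0 \<le> t" using V(1) by (auto simp: B_def)
      show "t \<in> {t0 - 3 * e..t0} \<union> {t0 - H<..t0 - H + 3 * e}"
      proof (rule ccontr)
        assume "t \<notin> {t0 - 3 * e..t0} \<union> {t0 - H<..t0 - H + 3 * e}"
        then have "{t0 - H - e..t0 - H + 2 * e} \<subseteq> {t - H + 2 * e<..<t - e}"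
          using t0(2)[OF t] \<open>0 \<le> t\<close> \<open>t0 < H\<close> e by auto
        then show False using not_both[OF \<open>t \<in> V\<close>] t0(1) by (auto simp: B_def)
      qed
    qed
    then have "card B \<le> card ({t0 - 3 * e..t0} \<union> {t0 - H<..t0 - H + 3 * e})"
      by (intro card_mono) auto
    also have "\<dots> \<le> card {t0 - 3 * e..t0} + card {t0 - H<..t0 - H + 3 * e}" by (rule card_Un_le)
    also have "\<dots> = nat (6 * e + 1)" using e by simp
    finally show ?thesis .
  qed (use e in simp)
  have "card V \<le> card (A \<union> B)" using \<open>V \<subseteq> A \<union> B\<close> fin by (intro card_mono) (auto simp: A_def B_def)
  also have "\<dots> \<le> card A + card B" by (rule card_Un_le)
  also have "\<dots> \<le> nat (12 * e + 2)" using cardA cardB e by linarith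
  finally show ?thesis .
qed

lemma card_le_by_pieces:
  fixes V :: "int set" and E :: real
  assumes "e > 0" "V \<subseteq> {0..<e * int k}"
    and "\<And>V'. V' \<subseteq> V \<Longrightarrow> (\<And>s t. s \<in> V' \<Longrightarrow> t \<in> V' \<Longrightarrow> \<bar>s - t\<bar> < e) \<Longrightarrow> V' \<noteq> {} \<Longrightarrow> real (card V') \<le> E"
    and "E \<ge> 0"
  shows "real (card V) \<le> real k * E"
proof -
  define P where "P j = V \<inter> {e * int j..<e * int (Suc j)}" for j
  have "V \<subseteq> (\<Union>j<k. P j)"
  proof
    fix t assume t: "t \<in> V"
    define j where "j = nat (t div e)"
    have "0 \<le> t" "t < e * int k" using t assms(2) by auto
    then have j: "int j = t div e" using \<open>e > 0\<close> by (simp add: j_def pos_imp_zdiv_nonneg_iff)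
    have "e * (t div e) \<le> t" "t < e * (t div e) + e"
      using \<open>e > 0\<close> by (metis mult_div_mod_eq pos_mod_sign pos_mod_bound add_le_cancel_left add.right_neutral, metis mult_div_mod_eq pos_mod_bound add_strict_left_mono)
    then have "t \<in> P j" using t by (simp add: P_def j algebra_simps)
    moreover have "j < k"
    proof -
      have "e * int j < e * int k" using \<open>e * (t div e) \<le> t\<close> \<open>t < e * int k\<close> j by simp
      then show ?thesis using \<open>e > 0\<close> by simp
    qed
    ultimately show "t \<in> (\<Union>j<k. P j)" by blast
  qed
  then have "card V \<le> card (\<Union>j<k. P j)" by (intro card_mono) (auto simp: P_def)
  also have "\<dots> \<le> (\<Sum>j<k. card (P j))" by (rule card_UN_le) simp
  finally have "real (card V) \<le> (\<Sum>j<k. real (card (P j)))" by (metis of_nat_le_iff of_nat_sum)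
  also have "\<dots> \<le> (\<Sum>j<k. E)"
  proof (intro sum_mono)
    fix j
    show "real (card (P j)) \<le> E"
    proof (cases "P j = {}")
      case False
      show ?thesis by (rule assms(3)) (use False in \<open>auto simp: P_def algebra_simps\<close>)
    qed (use \<open>E \<ge> 0\<close> in simp)
  qed
  finally show ?thesis by simp
qed

lemma card_image_le_card_image:
  assumes "finite (g ` K)" "\<And>y z. y \<in> K \<Longrightarrow> z \<in> K \<Longrightarrow> g y = g z \<Longrightarrow> f y = f z"
  shows "card (f ` K) \<le> card (g ` K)"
proof -
  have "f ` K = (\<lambda>v. f (inv_into K g v)) ` g ` K"
    unfolding image_image
  proof (rule image_cong[OF refl])
    fix y assume "y \<in> K"
    then show "f y = f (inv_into K g (g y))"
      by (intro assms(2)) (auto intro: inv_into_into f_inv_into_f[symmetric])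
  qed
  then show ?thesis using card_image_le[OF assms(1), of "\<lambda>v. f (inv_into K g v)"] by simp
qed

definition misses :: "nat list \<Rightarrow> int \<Rightarrow> (int \<Rightarrow> nat) set \<Rightarrow> bool" where
  "misses w t K \<longleftrightarrow> (\<forall>y\<in>K. subword y t (t + int (length w)) \<noteq> w)"

definition pattern_count :: "nat \<Rightarrow> int \<Rightarrow> (int \<Rightarrow> nat) set \<Rightarrow> nat" where
  "pattern_count m t K = card ((\<lambda>y. subword y (t - int m) (t + int m + 1)) ` K)"

context mixing_rank_one
begin

text \<open>The word of \<open>y\<close> in a window is determined by the set of starts of the blocks of \<open>y\<close>
  that meet this window. Hence more than \<open>2 ^ (3 * Q)\<close> patterns near \<open>t\<close> require
  more than \<open>3 * Q\<close> blocks that come near \<open>t\<close>, and \<open>poor_times_few\<close>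
  bounds the number of such times \<open>t\<close> that are not rich. The rich ones are treated by
  \<open>common_gaps_few\<close> on pieces of length \<open>e\<close>: the blocks that make one time of a
  piece rich contain the whole piece, together with room for \<open>w\<close>.\<close>

lemma missing_times_at_scale:
  assumes w: "w \<noteq> []" "measure M (cylinder X w) > 0" and "K \<subseteq> X" and "\<epsilon> > 0" "D > 0" "Q > 0" "r > 0"
    and corr: "\<And>d. d \<ge> D \<Longrightarrow>
     \<bar>\<Sum>i | i + d + length w \<le> h n. centred w (shift_action (int i) x) * centred w (shift_action (int (i + d)) x)\<bar>
       \<le> \<epsilon> * real (h n)"
    and e: "length w \<le> e" "m \<le> e" "e * r \<le> h n" "h n < (e + 1) * r"
  shows "real (card {t\<in>{0..<int (h n)}. misses w t K}) \<le>
     real (card {t\<in>{0..<int (h n)}. pattern_count m t K \<le> 2 ^ (3 * Q)}) + real (12 * e + 2)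
      + real (2 * r) * ((2 * real D / real Q + \<epsilon>) * real (h n) / (measure M (cylinder X w))\<^sup>2)"
proof -
  let ?H = "int (h n)" and ?u = "measure M (cylinder X w)" and ?e = "int e" and ?om = "omega q a n"
  have "e > 0" using w(1) e(1) by (cases w) auto
  then have "e \<le> e * r" using \<open>r > 0\<close> by simp
  then have eH: "e \<le> h n" using e(3) by linarith
  have "\<forall>y\<in>K. \<exists>S. block_cover ?om (- 3 * ?H) (3 * ?H) y S"
    using block_cover_exists[of q _ a, OF q_pos] \<open>K \<subseteq> X\<close> by blast
  then obtain S where S: "\<And>y. y \<in> K \<Longrightarrow> block_cover ?om (- 3 * ?H) (3 * ?H) y (S y)"
    using bchoice[of K "\<lambda>y S. block_cover ?om (- 3 * ?H) (3 * ?H) y S"] by blast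
  have S1: "y (s + int u) = ?om ! u"
    if "y \<in> K" "s \<in> S y" "u < h n" "- 3 * ?H \<le> s + int u" "s + int u < 3 * ?H" for y s u
    using S[OF that(1)] that(2-5) unfolding block_cover_def by blast
  have S2: "\<exists>s\<in>S y. s \<le> p \<and> p < s + ?H"
    if "y \<in> K" "- 3 * ?H \<le> p" "p < 3 * ?H" "y p \<noteq> 0" for y p
    using S[OF that(1)] that(2-4) unfolding block_cover_def by blast
  \<comment> \<open>For times in \<open>[0, H)\<close>, all windows and block starts that matter lie in
    \<open>[-3 H, 3 H)\<close>.\<close>
  define SS where "SS = (\<Union>y\<in>K. S y) \<inter> {- 3 * ?H..3 * ?H}"
  have finSS: "finite SS" by (simp add: SS_def)
  define R where "R t = SS \<inter> {t - ?H + 2 * ?e<..<t - ?e}" for t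
  define V where "V = {t\<in>{0..<?H}. misses w t K \<and> pattern_count m t K > 2 ^ (3 * Q)}"
  define V_poor where "V_poor = {t\<in>V. card (R t) < Q}"
  define V_rich where "V_rich = {t\<in>V. card (R t) \<ge> Q}"
  have Vsub: "V \<subseteq> {0..<?H}" by (auto simp: V_def)
  then have finV: "finite V" using finite_subset by blast
  have "card V_poor \<le> nat (12 * ?e + 2)"
  proof (rule poor_times_few[of ?e V_poor ?H SS Q])
    fix t assume "t \<in> V_poor"
    then have t: "0 \<le> t" "t < ?H" "pattern_count m t K > 2 ^ (3 * Q)" by (auto simp: V_poor_def V_def)
    show "card (SS \<inter> {t - ?H + 2 * ?e<..<t - ?e}) < Q" using \<open>t \<in> V_poor\<close> by (simp add: V_poor_def R_def)
    let ?I = "{t - ?H - ?e..t + ?e}"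
    have sub: "(\<lambda>y. S y \<inter> ?I) ` K \<subseteq> Pow (SS \<inter> ?I)" using t eH by (auto simp: SS_def)
    have fin: "finite (Pow (SS \<inter> ?I))" using finSS by simp
    have "pattern_count m t K \<le> card ((\<lambda>y. S y \<inter> ?I) ` K)"
      unfolding pattern_count_def
    proof (rule card_image_le_card_image)
      show "finite ((\<lambda>y. S y \<inter> ?I) ` K)" using finite_subset[OF sub fin] .
      have *: "y p = z p" if yz: "y \<in> K" "z \<in> K" "S y \<inter> ?I = S z \<inter> ?I"
         and p: "t - int m \<le> p" "p < t + int m + 1" and nz: "y p \<noteq> 0" for y z p
      proof -
        have p': "- 3 * ?H \<le> p" "p < 3 * ?H" using p t e(2) eH \<open>e > 0\<close> by linarith+
        obtain s where s: "s \<in> S y" "s \<le> p" "p < s + ?H" using S2[OF yz(1) p' nz] by blast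
        then have "s \<in> ?I" using p e(2) by simp
        then have "s \<in> S z" using s(1) yz(3) by blast
        have "nat (p - s) < h n" "p = s + int (nat (p - s))" using s by auto
        then show ?thesis
          using S1[OF yz(1) s(1), of "nat (p - s)"] S1[OF yz(2) \<open>s \<in> S z\<close>, of "nat (p - s)"] p' by simp
      qed
      show "subword y (t - int m) (t + int m + 1) = subword z (t - int m) (t + int m + 1)"
        if "y \<in> K" "z \<in> K" "S y \<inter> ?I = S z \<inter> ?I" for y z
        unfolding subword_eq_subword_iff
        using *[OF that] *[OF that(2,1) that(3)[symmetric]] by metis
    qed
    also have "\<dots> \<le> card (Pow (SS \<inter> ?I))" by (rule card_mono[OF fin sub])
    also have "\<dots> = 2 ^ card (SS \<inter> ?I)" using finSS by (intro card_Pow) simp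
    finally have "(2::nat) ^ (3 * Q) < 2 ^ card (SS \<inter> ?I)" using t(3) by (rule less_le_trans[rotated])
    then have "3 * Q < card (SS \<inter> ?I)" by (rule power_less_imp_less_exp[rotated]) simp
    then show "3 * Q \<le> card (SS \<inter> ?I)" by simp
  qed (use Vsub finSS in \<open>auto simp: V_poor_def\<close>)
  then have poor: "real (card V_poor) \<le> real (12 * e + 2)" by linarith
  have rich: "real (card V_rich) \<le> real (2 * r) * ((2 * real D / real Q + \<epsilon>) * real (h n) / ?u\<^sup>2)"
  proof (rule card_le_by_pieces[of ?e])
    show "0 < ?e" using \<open>e > 0\<close> by simp
    have "(e + 1) * r \<le> (e + e) * r" using \<open>e > 0\<close> by (intro mult_right_mono) auto
    with e(4) have "h n \<le> (e + e) * r" by (rule less_imp_le[OF less_le_trans])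
    then have "h n \<le> e * (2 * r)" by (simp add: mult.assoc mult.left_commute flip: mult_2)
    then have "?H \<le> ?e * int (2 * r)" by (metis of_nat_le_iff of_nat_mult)
    then show "V_rich \<subseteq> {0..<?e * int (2 * r)}" using Vsub by (auto simp: V_rich_def)
    show "0 \<le> (2 * real D / real Q + \<epsilon>) * real (h n) / ?u\<^sup>2" using \<open>\<epsilon> > 0\<close> by simp
  next
    fix V' assume V': "V' \<subseteq> V_rich" "\<And>s t. s \<in> V' \<Longrightarrow> t \<in> V' \<Longrightarrow> \<bar>s - t\<bar> < ?e" "V' \<noteq> {}"
    then obtain t0 where t0: "t0 \<in> V'" by blast
    then have Q: "card (R t0) \<ge> Q" using V'(1) by (auto simp: V_rich_def)
    have "real (card V') * ?u\<^sup>2 * real (card (R t0)) \<le> (2 * real D + \<epsilon> * real (card (R t0))) * real (h n)"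
    proof (rule common_gaps_few[OF w(1) \<open>D > 0\<close> \<open>\<epsilon> > 0\<close> _ _ corr])
      show "finite (R t0)" using finSS by (simp add: R_def)
      show "finite V'" using finV V'(1) finite_subset unfolding V_rich_def by (metis (no_types, lifting) mem_Collect_eq subsetI)
      fix t s assume t: "t \<in> V'" and s: "s \<in> R t0"
      have tt: "misses w t K" "0 \<le> t" "t < ?H" using t V'(1) by (auto simp: V_rich_def V_def)
      have dist: "\<bar>t - t0\<bar> < ?e" using V'(2)[OF t t0] .
      have 1: "0 \<le> t - s" "t - s + int (length w) \<le> ?H"
        using s dist e(1) by (auto simp: R_def)
      obtain y where y: "y \<in> K" "s \<in> S y" using s by (auto simp: R_def SS_def)
      have "subword x (t - s) (t - s + int (length w)) \<noteq> w"
      proof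
        assume occ: "subword x (t - s) (t - s + int (length w)) = w"
        have "y (t + int k) = w ! k" if k: "k < length w" for k
        proof -
          have u: "nat (t - s) + k < h n" "int (nat (t - s) + k) = t - s + int k"
            using 1 k by auto
          have "y (t + int k) = ?om ! (nat (t - s) + k)"
            using S1[OF y u(1)] u(2) tt(2,3) k e(1) eH by simp
          also have "\<dots> = x (int (nat (t - s) + k))"
            by (rule x_nth[OF u(1), symmetric])
          also have "\<dots> = w ! k"
            using occ k unfolding u(2) subword_eq_iff by blast
          finally show ?thesis .
        qed
        then have "subword y t (t + int (length w)) = w" using subword_eq_iff by blast
        then show False using tt(1) y(1) by (simp add: misses_def)
      qed
      then show "0 \<le> t - s \<and> t - s + int (length w) \<le> ?H \<and> occurs w (shift_action (t - s) x) = 0"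
        using 1 by (simp add: occurs_def subword_shift add.commute)
    qed
    then have "real (card V') * ?u\<^sup>2 \<le> (2 * real D + \<epsilon> * real (card (R t0))) * real (h n) / real (card (R t0))"
      using Q \<open>Q > 0\<close> by (simp add: pos_le_divide_eq)
    also have "\<dots> = (2 * real D / real (card (R t0)) + \<epsilon>) * real (h n)"
      using Q \<open>Q > 0\<close> by (simp add: divide_simps)
    also have "\<dots> \<le> (2 * real D / real Q + \<epsilon>) * real (h n)"
      using Q \<open>Q > 0\<close> by (intro mult_right_mono add_right_mono divide_left_mono) auto
    finally show "real (card V') \<le> (2 * real D / real Q + \<epsilon>) * real (h n) / ?u\<^sup>2"
      using w(2) by (simp add: pos_le_divide_eq)
  qed
  have "card {t\<in>{0..<?H}. misses w t K} \<le>
      card ({t\<in>{0..<?H}. pattern_count m t K \<le> 2 ^ (3 * Q)} \<union> (V_poor \<union> V_rich))"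
  proof (intro card_mono)
    show "finite ({t\<in>{0..<?H}. pattern_count m t K \<le> 2 ^ (3 * Q)} \<union> (V_poor \<union> V_rich))"
      by (rule finite_subset[of _ "{0..<?H}"]) (auto simp: V_poor_def V_rich_def V_def)
  qed (auto simp: V_poor_def V_rich_def V_def)
  also have "\<dots> \<le> card {t\<in>{0..<?H}. pattern_count m t K \<le> 2 ^ (3 * Q)} + (card V_poor + card V_rich)"
    by (rule order_trans[OF card_Un_le add_left_mono[OF card_Un_le]])
  finally show ?thesis using poor rich by linarith
qed

text \<open>The order of the choices matters: \<open>r\<close> controls the number of poor times,
  \<open>\<epsilon>'\<close> and \<open>D\<close> the correlations, \<open>Q\<close> the close pairs, and only
  then, for given \<open>m\<close>, the level \<open>n\<close> is taken. Thus \<open>N = 2 ^ (3 * Q)\<close>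
  serves for all \<open>m\<close>.\<close>

lemma missing_times_few:
  assumes w: "w \<noteq> []" "measure M (cylinder X w) > 0" and "\<epsilon> > 0"
  obtains N where "\<And>m. \<exists>H>0. \<forall>K\<subseteq>X.
     real (card {t\<in>{0..<int H}. misses w t K}) \<le> real (card {t\<in>{0..<int H}. pattern_count m t K \<le> N}) + \<epsilon> * real H"
proof -
  let ?u = "measure M (cylinder X w)"
  define r where "r = nat \<lceil>48 / \<epsilon>\<rceil> + 1"
  have r: "r > 0" "48 / \<epsilon> \<le> real r" unfolding r_def by linarith+
  define \<epsilon>' where "\<epsilon>' = \<epsilon> * ?u\<^sup>2 / (8 * real r)"
  have "\<epsilon>' > 0" using \<open>\<epsilon> > 0\<close> w r by (simp add: \<epsilon>'_def)
  obtain D n0 where "D > 0" and corr: "\<And>n d. n \<ge> n0 \<Longrightarrow> d \<ge> D \<Longrightarrow>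
     \<bar>\<Sum>i | i + d + length w \<le> h n. centred w (shift_action (int i) x) * centred w (shift_action (int (i + d)) x)\<bar>
       \<le> \<epsilon>' * real (h n)"
    using correlation_small[OF w(1) \<open>\<epsilon>' > 0\<close>] by blast
  define Q where "Q = nat \<lceil>16 * real r * real D / (\<epsilon> * ?u\<^sup>2)\<rceil> + 1"
  have Q: "Q > 0" "16 * real r * real D / (\<epsilon> * ?u\<^sup>2) \<le> real Q" unfolding Q_def by linarith+
  show thesis
  proof (rule that[of "2 ^ (3 * Q)"])
    fix m
    define e0 where "e0 = max m (length w)"
    obtain n1 where n1: "\<And>n. n \<ge> n1 \<Longrightarrow> real (h n) \<ge> max (real (r * e0)) (8 / \<epsilon>)" using h_ge by blast
    define n where "n = max n0 n1"
    have hn: "r * e0 \<le> h n" "8 / \<epsilon> \<le> real (h n)" using n1[of n] by (auto simp: n_def simp del: of_nat_mult)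
    define e where "e = h n div r"
    have "e0 \<le> e" using hn(1) r(1) by (simp add: e_def less_eq_div_iff_mult_less_eq mult.commute)
    have "e * r \<le> h n" by (simp add: e_def)
    have "h n < (e + 1) * r" using r(1) by (simp add: e_def dividend_less_div_times)
    have hpos: "real (h n) > 0" using hn(2) \<open>\<epsilon> > 0\<close> by (smt (verit) divide_pos_pos)
    have "real e * real r \<le> real (h n)" using \<open>e * r \<le> h n\<close> by (metis of_nat_le_iff of_nat_mult)
    moreover have "48 \<le> \<epsilon> * real r" using r(2) \<open>\<epsilon> > 0\<close> by (simp add: pos_divide_le_eq mult.commute)
    ultimately have "12 * real e \<le> \<epsilon> / 4 * real (h n)"
    proof -
      assume *: "real e * real r \<le> real (h n)" "48 \<le> \<epsilon> * real r"
      have "48 * real e \<le> \<epsilon> * real r * real e" using *(2) by (intro mult_right_mono) auto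
      also have "\<dots> = \<epsilon> * (real e * real r)" by simp
      also have "\<dots> \<le> \<epsilon> * real (h n)" using *(1) \<open>\<epsilon> > 0\<close> by (intro mult_left_mono) auto
      finally show ?thesis by simp
    qed
    moreover have "2 \<le> \<epsilon> / 4 * real (h n)" using hn(2) \<open>\<epsilon> > 0\<close> by (simp add: pos_divide_le_eq mult.commute)
    moreover have "real (2 * r) * ((2 * real D / real Q + \<epsilon>') * real (h n) / ?u\<^sup>2) \<le> \<epsilon> / 2 * real (h n)"
    proof -
      have "16 * real r * real D \<le> real Q * (\<epsilon> * ?u\<^sup>2)"
        using Q(2) \<open>\<epsilon> > 0\<close> w(2) by (simp add: pos_divide_le_eq)
      then have 1: "4 * real r * real D / (real Q * ?u\<^sup>2) \<le> \<epsilon> / 4"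
        using Q(1) w(2) by (simp add: divide_simps mult_ac)
      have "real (2 * r) * ((2 * real D / real Q + \<epsilon>') / ?u\<^sup>2) =
          4 * real r * real D / (real Q * ?u\<^sup>2) + \<epsilon> / 4"
        using w(2) r(1) Q(1) by (simp add: \<epsilon>'_def field_simps)
      also have "\<dots> \<le> \<epsilon> / 2" using 1 by simp
      finally have "real (2 * r) * ((2 * real D / real Q + \<epsilon>') / ?u\<^sup>2) * real (h n) \<le> \<epsilon> / 2 * real (h n)"
        by (intro mult_right_mono) auto
      then show ?thesis by simp
    qed
    ultimately have small: "real (12 * e + 2) + real (2 * r) * ((2 * real D / real Q + \<epsilon>') * real (h n) / ?u\<^sup>2)
       \<le> \<epsilon> * real (h n)" by simp
    show "\<exists>H>0. \<forall>K\<subseteq>X. real (card {t\<in>{0..<int H}. misses w t K}) \<le>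
        real (card {t\<in>{0..<int H}. pattern_count m t K \<le> 2 ^ (3 * Q)}) + \<epsilon> * real H"
    proof (intro exI[of _ "h n"] conjI allI impI)
      fix K assume "K \<subseteq> X"
      have "n \<ge> n0" by (simp add: n_def)
      show "real (card {t\<in>{0..<int (h n)}. misses w t K}) \<le>
        real (card {t\<in>{0..<int (h n)}. pattern_count m t K \<le> 2 ^ (3 * Q)}) + \<epsilon> * real (h n)"
        using missing_times_at_scale[OF w \<open>K \<subseteq> X\<close> \<open>\<epsilon>' > 0\<close> \<open>D > 0\<close> Q(1) r(1) corr[OF \<open>n \<ge> n0\<close>], of e m]
          \<open>e0 \<le> e\<close> \<open>e * r \<le> h n\<close> \<open>h n < (e + 1) * r\<close> small by (simp add: e0_def)
    qed (use hpos in simp)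
  qed
qed

end

section \<open>Measurability in the hyperspace\<close>

lemma topspace_hyperspace_topology: "topspace (hyperspace_topology X) = hyperspace X"
  unfolding hyperspace_topology_def
  using Metric_space.topspace_mtopology[OF Metric_space_hyperspace] .

lemma sets_hyperspace_borel:
  "sets (hyperspace_borel X) = sigma_sets (hyperspace X) {U. openin (hyperspace_topology X) U}"
  and space_hyperspace_borel: "space (hyperspace_borel X) = hyperspace X"
proof -
  have "{U. openin (hyperspace_topology X) U} \<subseteq> Pow (hyperspace X)"
    using openin_subset topspace_hyperspace_topology by blast
  then show "sets (hyperspace_borel X) = sigma_sets (hyperspace X) {U. openin (hyperspace_topology X) U}"
     "space (hyperspace_borel X) = hyperspace X"
    by (simp_all add: hyperspace_borel_def)
qed

text \<open>A point of \<open>K\<close> in \<open>U\<close> has points of all sets close to \<open>K\<close> nearby.\<close>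

lemma openin_hits:
  assumes "open U" shows "openin (hyperspace_topology X) {K \<in> hyperspace X. K \<inter> U \<noteq> {}}"
proof -
  interpret Metric_space "hyperspace X" hausdorff_dist by (rule Metric_space_hyperspace)
  show ?thesis
    unfolding hyperspace_topology_def openin_mtopology
  proof (intro conjI allI impI)
    fix K assume "K \<in> {K \<in> hyperspace X. K \<inter> U \<noteq> {}}"
    then obtain y where K: "K \<in> hyperspace X" "y \<in> K" "y \<in> U" by blast
    then obtain r where r: "r > 0" "ball y r \<subseteq> U" using \<open>open U\<close> open_contains_ball by blast
    have "mball K r \<subseteq> {K \<in> hyperspace X. K \<inter> U \<noteq> {}}"
    proof
      fix K' assume "K' \<in> mball K r"
      then have K': "K' \<in> hyperspace X" "hausdorff_dist K K' < r" by auto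
      have "infdist y K' < r"
        using hausdorff_dist_upper1[of K K' y] K K' by (auto simp: hyperspace_def)
      moreover have "K' \<noteq> {}" using K' by (auto simp: hyperspace_def)
      ultimately obtain z where "z \<in> K'" "dist y z < r"
        by (auto simp: infdist_notempty cINF_less_iff)
      then have "z \<in> K' \<inter> U" using r(2) by auto
      then show "K' \<in> {K \<in> hyperspace X. K \<inter> U \<noteq> {}}" using K'(1) by blast
    qed
    then show "\<exists>r>0. mball K r \<subseteq> {K \<in> hyperspace X. K \<inter> U \<noteq> {}}" using r(1) by blast
  qed auto
qed

lemma open_subword: "open {y. subword y i j = w}"
proof (subst open_subopen, intro ballI)
  fix y assume y: "y \<in> {y. subword y i j = w}"
  let ?T = "\<Inter>k\<in>{i..j - 1}. (\<lambda>z::int \<Rightarrow> nat. z k) -` {y k}"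
  have "open ?T"
    by (intro open_INT ballI open_vimage continuous_on_product_coordinates)
      (auto intro: Topological_Spaces.open_discrete)
  moreover have "?T \<subseteq> {y. subword y i j = w}"
  proof
    fix z assume "z \<in> ?T"
    then have "subword z i j = subword y i j" by (auto simp: subword_def)
    then show "z \<in> {y. subword y i j = w}" using y by simp
  qed
  ultimately show "\<exists>T. open T \<and> y \<in> T \<and> T \<subseteq> {y. subword y i j = w}" by blast
qed

lemma hits_subword_sets:
  "{K \<in> hyperspace X. \<exists>y\<in>K. subword y i j = w} \<in> sets (hyperspace_borel X)"
proof -
  have "{K \<in> hyperspace X. \<exists>y\<in>K. subword y i j = w} = {K \<in> hyperspace X. K \<inter> {y. subword y i j = w} \<noteq> {}}"
    by blast
  then show ?thesis
    using openin_hits[OF open_subword[of i j w], of X] by (simp add: sets_hyperspace_borel)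
qed

lemma misses_sets: "{K \<in> hyperspace X. misses w t K} \<in> sets (hyperspace_borel X)"
proof -
  have "{K \<in> hyperspace X. misses w t K} =
      space (hyperspace_borel X) - {K \<in> hyperspace X. \<exists>y\<in>K. subword y t (t + int (length w)) = w}"
    by (auto simp: misses_def space_hyperspace_borel)
  then show ?thesis using sets.compl_sets[OF hits_subword_sets[of X t "t + int (length w)" w]] by simp
qed

lemma finite_patterns:
  assumes "K \<subseteq> rank_one_subshift q a" shows "finite ((\<lambda>y. subword y i j) ` K)"
proof (rule finite_subset[OF _ finite_binary_words])
  show "(\<lambda>y. subword y i j) ` K \<subseteq> binary_words (nat (j - i))"
    using subword_in_binary_words[of _ q a i j] assms by blast
qed

text \<open>More than \<open>N\<close> patterns occur iff \<open>K\<close> hits all cylinders from one of countably many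
  finite families.\<close>

lemma pattern_count_sets:
  assumes X: "X = rank_one_subshift q a"
  shows "{K \<in> hyperspace X. pattern_count m t K \<le> N} \<in> sets (hyperspace_borel X)"
proof -
  let ?i = "t - int m" and ?j = "t + int m + 1"
  let ?A = "{A :: nat list set. finite A \<and> card A > N}"
  let ?W = "\<Union>A\<in>?A. \<Inter>v\<in>A. {K \<in> hyperspace X. \<exists>y\<in>K. subword y ?i ?j = v}"
  have "?W \<in> sets (hyperspace_borel X)"
  proof (rule sets.countable_UN'')
    show "countable ?A" by (rule countable_subset[OF _ countable_Collect_finite]) auto
    fix A :: "nat list set" assume "A \<in> ?A"
    then have "finite A" "A \<noteq> {}" by auto
    then show "(\<Inter>v\<in>A. {K \<in> hyperspace X. \<exists>y\<in>K. subword y ?i ?j = v}) \<in> sets (hyperspace_borel X)"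
      by (intro sets.finite_INT hits_subword_sets)
  qed
  moreover have "{K \<in> hyperspace X. pattern_count m t K \<le> N} = space (hyperspace_borel X) - ?W"
  proof (intro equalityI subsetI)
    fix K assume K: "K \<in> {K \<in> hyperspace X. pattern_count m t K \<le> N}"
    have "K \<notin> ?W"
    proof
      assume "K \<in> ?W"
      then obtain A where A: "finite A" "card A > N" "A \<subseteq> (\<lambda>y. subword y ?i ?j) ` K" by force
      then have "card A \<le> pattern_count m t K"
        unfolding pattern_count_def using K X
        by (intro card_mono finite_patterns[of K q a]) (auto simp: hyperspace_def)
      then show False using A(2) K by simp
    qed
    then show "K \<in> space (hyperspace_borel X) - ?W" using K by (simp add: space_hyperspace_borel)
  next
    fix K assume K: "K \<in> space (hyperspace_borel X) - ?W"
    let ?A = "(\<lambda>y. subword y ?i ?j) ` K"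
    have KX: "K \<in> hyperspace X" using K by (simp add: space_hyperspace_borel)
    then have "finite ?A" using X by (intro finite_patterns[of K q a]) (auto simp: hyperspace_def)
    then have "\<not> card ?A > N" using K KX by blast
    then show "K \<in> {K \<in> hyperspace X. pattern_count m t K \<le> N}"
      using KX by (simp add: pattern_count_def)
  qed
  ultimately show ?thesis using sets.compl_sets[of ?W "hyperspace_borel X"] by simp
qed

lemma pattern_count_mono:
  assumes "K \<subseteq> rank_one_subshift q a" "m \<le> m'"
  shows "pattern_count m t K \<le> pattern_count m' t K"
  unfolding pattern_count_def
proof (rule card_image_le_card_image[OF finite_patterns[OF assms(1)]])
  fix y z assume "subword y (t - int m') (t + int m' + 1) = subword z (t - int m') (t + int m' + 1)"
  then show "subword y (t - int m) (t + int m + 1) = subword z (t - int m) (t + int m + 1)"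
    using assms(2) unfolding subword_eq_subword_iff by auto
qed

text \<open>Finitely many distinct points are told apart by a sufficiently large window.\<close>

lemma infinite_iff_pattern_count:
  assumes "K \<subseteq> rank_one_subshift q a"
  shows "infinite K \<longleftrightarrow> (\<forall>N. \<exists>m. pattern_count m 0 K > N)"
proof
  assume inf: "infinite K"
  show "\<forall>N. \<exists>m. pattern_count m 0 K > N"
  proof
    fix N
    obtain P where P: "P \<subseteq> K" "finite P" "card P = Suc N"
      using infinite_arbitrarily_large[OF inf] by blast
    define d where "d y z = (SOME k. y k \<noteq> z k)" for y z :: "int \<Rightarrow> nat"
    have d: "y (d y z) \<noteq> z (d y z)" if "y \<noteq> z" for y z
    proof -
      have "\<exists>k. y k \<noteq> z k" using that by (simp add: fun_eq_iff)
      then show ?thesis unfolding d_def by (rule someI_ex)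
    qed
    have "finite ((\<lambda>(y, z). nat \<bar>d y z\<bar>) ` (P \<times> P))" using P(2) by simp
    then obtain m where "\<forall>k\<in>(\<lambda>(y, z). nat \<bar>d y z\<bar>) ` (P \<times> P). k \<le> m"
      unfolding finite_nat_set_iff_bounded_le ..
    then have m: "nat \<bar>d y z\<bar> \<le> m" if "y \<in> P" "z \<in> P" for y z using that by fast
    have "inj_on (\<lambda>y. subword y (0 - int m) (0 + int m + 1)) P"
    proof (rule inj_onI, rule ccontr)
      fix y z assume *: "y \<in> P" "z \<in> P" "y \<noteq> z"
        "subword y (0 - int m) (0 + int m + 1) = subword z (0 - int m) (0 + int m + 1)"
      have "- int m \<le> d y z" "d y z \<le> int m" using m[OF *(1,2)] by linarith+
      then show False using *(4) d[OF *(3)] unfolding subword_eq_subword_iff by auto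
    qed
    then have "card ((\<lambda>y. subword y (0 - int m) (0 + int m + 1)) ` P) = Suc N"
      using P(3) by (simp add: card_image)
    moreover have "card ((\<lambda>y. subword y (0 - int m) (0 + int m + 1)) ` P) \<le> pattern_count m 0 K"
      unfolding pattern_count_def using P(1) by (intro card_mono finite_patterns[OF assms] image_mono)
    ultimately show "\<exists>m. pattern_count m 0 K > N" by (intro exI[of _ m]) simp
  qed
next
  assume *: "\<forall>N. \<exists>m. pattern_count m 0 K > N"
  show "infinite K"
  proof
    assume "finite K"
    then have "pattern_count m 0 K \<le> card K" for m
      unfolding pattern_count_def by (rule card_image_le)
    then show False using * by (meson not_less)
  qed
qed

lemma infinite_sets:
  assumes X: "X = rank_one_subshift q a"
  shows "{K \<in> hyperspace X. infinite K} \<in> sets (hyperspace_borel X)"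
proof -
  have "{K \<in> hyperspace X. infinite K} =
     (\<Inter>N. \<Union>m. space (hyperspace_borel X) - {K \<in> hyperspace X. pattern_count m 0 K \<le> N})"
    (is "_ = ?R")
  proof (intro set_eqI)
    fix K
    show "K \<in> {K \<in> hyperspace X. infinite K} \<longleftrightarrow> K \<in> ?R"
    proof (cases "K \<in> hyperspace X")
      case True
      then have "infinite K \<longleftrightarrow> (\<forall>N. \<exists>m. pattern_count m 0 K > N)"
        using X by (intro infinite_iff_pattern_count[of K q a]) (simp add: hyperspace_def)
      then show ?thesis using True by (simp add: space_hyperspace_borel not_le)
    qed (simp add: space_hyperspace_borel)
  qed
  also have "\<dots> \<in> sets (hyperspace_borel X)"
  proof (rule sets.countable_INT')
    show "range (\<lambda>N. \<Union>m. space (hyperspace_borel X) - {K \<in> hyperspace X. pattern_count m 0 K \<le> N})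
        \<subseteq> sets (hyperspace_borel X)"
      by (intro image_subsetI sets.countable_UN'' sets.compl_sets pattern_count_sets[OF X]) auto
  qed auto
  finally show ?thesis .
qed

lemma cylinder_avoiding_closed:
  fixes y :: "int \<Rightarrow> nat"
  assumes "closed K" "y \<notin> K"
  obtains m where "\<And>z. subword z (- int m) (int m + 1) = subword y (- int m) (int m + 1) \<Longrightarrow> z \<notin> K"
proof -
  have "openin (product_topology (\<lambda>_::int. euclidean) UNIV) (- K)"
    using assms(1) by (simp add: euclidean_product_topology open_Compl)
  then obtain B where B: "y \<in> (\<Pi>\<^sub>E i\<in>UNIV. B i)" "finite {i. B i \<noteq> UNIV}" "(\<Pi>\<^sub>E i\<in>UNIV. B i) \<subseteq> - K"
    using product_topology_open_contains_basis[of "\<lambda>_. euclidean" UNIV "- K" y] assms(2) by auto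
  have "finite ((\<lambda>i. nat \<bar>i\<bar>) ` {i. B i \<noteq> UNIV})" using B(2) by simp
  then obtain m where m: "\<And>i. B i \<noteq> UNIV \<Longrightarrow> nat \<bar>i\<bar> \<le> m"
    unfolding finite_nat_set_iff_bounded_le by auto
  show thesis
  proof (rule that[of m])
    fix z assume *: "subword z (- int m) (int m + 1) = subword y (- int m) (int m + 1)"
    have "z i \<in> B i" for i
    proof (cases "B i = UNIV")
      case False
      then have "- int m \<le> i" "i < int m + 1" using m[OF False] by linarith+
      then have "z i = y i" using * unfolding subword_eq_subword_iff by blast
      then show ?thesis using B(1) by auto
    qed simp
    then have "z \<in> (\<Pi>\<^sub>E i\<in>UNIV. B i)" by auto
    then show "z \<notin> K" using B(3) by blast
  qed
qed

lemma misses_shift: "misses w t (shift_action s ` K) \<longleftrightarrow> misses w (t + s) K"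
  by (simp add: misses_def subword_shift algebra_simps)

lemma pattern_count_shift: "pattern_count m t (shift_action s ` K) = pattern_count m (t + s) K"
  by (simp add: pattern_count_def subword_shift image_image algebra_simps)

lemma infinite_shift_iff: "infinite (shift_action s ` K) \<longleftrightarrow> infinite K"
proof -
  have "inj (shift_action s)"
    by (rule inj_on_inverseI[where g = "shift_action (- s)"]) (simp flip: shift_action_add add: shift_action_0)
  then show ?thesis by (metis finite_image_iff inj_on_subset subset_UNIV)
qed

lemma shift_hyperspace:
  assumes "X = rank_one_subshift q a"
  shows "shift_action s ` K \<in> hyperspace X \<longleftrightarrow> K \<in> hyperspace X"
proof -
  have *: "shift_action s ` K \<in> hyperspace X" if "K \<in> hyperspace X" for s K
    using that assms shift_action_rank_one_subshift[of s q a]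
    by (auto simp: hyperspace_def intro!: compact_continuous_image continuous_on_shift_action)
  have "shift_action (- s) ` shift_action s ` K = K"
    by (simp add: image_image shift_action_0 flip: shift_action_add)
  then show ?thesis using *[of K s] *[of "shift_action s ` K" "- s"] by metis
qed

section \<open>Invariant random compact sets\<close>

locale invariant_random_compact = mixing_rank_one + \<nu>: prob_space \<nu> for \<nu> :: "(int \<Rightarrow> nat) set measure" +
  assumes sets_\<nu>: "sets \<nu> = sets (hyperspace_borel (rank_one_subshift q a))"
    and inv_\<nu>: "invariant_measure (\<lambda>g K. shift_action g ` K) \<nu>"
begin

lemma space_\<nu>: "space \<nu> = hyperspace X"
  using sets_eq_imp_space_eq[OF sets_\<nu>] by (simp add: space_hyperspace_borel)

lemma \<nu>_shift:
  assumes "{K \<in> hyperspace X. P K} \<in> sets \<nu>"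
  shows "{K \<in> hyperspace X. P (shift_action s ` K)} \<in> sets \<nu>"
    and "measure \<nu> {K \<in> hyperspace X. P (shift_action s ` K)} = measure \<nu> {K \<in> hyperspace X. P K}"
proof -
  have m: "(`) (shift_action s) \<in> measurable \<nu> \<nu>" and d: "distr \<nu> \<nu> ((`) (shift_action s)) = \<nu>"
    using inv_\<nu> unfolding invariant_measure_def by auto
  have eq: "{K \<in> hyperspace X. P (shift_action s ` K)} = (`) (shift_action s) -` {K \<in> hyperspace X. P K} \<inter> space \<nu>"
    using shift_hyperspace[of X q a s] by (auto simp: space_\<nu>)
  show "{K \<in> hyperspace X. P (shift_action s ` K)} \<in> sets \<nu>"
    unfolding eq by (rule measurable_sets[OF m assms])
  have "measure \<nu> {K \<in> hyperspace X. P K} = measure (distr \<nu> \<nu> ((`) (shift_action s))) {K \<in> hyperspace X. P K}"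
    by (simp only: d)
  also have "\<dots> = measure \<nu> {K \<in> hyperspace X. P (shift_action s ` K)}"
    unfolding eq by (rule measure_distr[OF m assms])
  finally show "measure \<nu> {K \<in> hyperspace X. P (shift_action s ` K)} = measure \<nu> {K \<in> hyperspace X. P K}" ..
qed

lemma sets_infinite_misses: "{K \<in> hyperspace X. infinite K \<and> misses w t K} \<in> sets \<nu>"
proof -
  have "{K \<in> hyperspace X. infinite K \<and> misses w t K} =
      {K \<in> hyperspace X. infinite K} \<inter> {K \<in> hyperspace X. misses w t K}" by blast
  then show ?thesis
    using sets.Int[OF infinite_sets[OF refl, of q a] misses_sets[of X w t]] by (simp only: sets_\<nu>)
qed

lemma sets_infinite_narrow: "{K \<in> hyperspace X. infinite K \<and> pattern_count m t K \<le> N} \<in> sets \<nu>"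
proof -
  have "{K \<in> hyperspace X. infinite K \<and> pattern_count m t K \<le> N} =
      {K \<in> hyperspace X. infinite K} \<inter> {K \<in> hyperspace X. pattern_count m t K \<le> N}" by blast
  then show ?thesis
    using sets.Int[OF infinite_sets[OF refl, of q a] pattern_count_sets[OF refl, of q a m t N]]
    by (simp only: sets_\<nu>)
qed

lemma measure_infinite_narrow_tendsto_0:
  "(\<lambda>m. measure \<nu> {K \<in> hyperspace X. infinite K \<and> pattern_count m 0 K \<le> N}) \<longlonglongrightarrow> 0"
proof -
  let ?A = "\<lambda>m. {K \<in> hyperspace X. infinite K \<and> pattern_count m 0 K \<le> N}"
  have "decseq ?A"
  proof (rule decseq_SucI, rule subsetI)
    fix m K assume "K \<in> ?A (Suc m)"
    then show "K \<in> ?A m"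
      using pattern_count_mono[of K q a m "Suc m" 0] by (auto simp: hyperspace_def)
  qed
  then have "(\<lambda>m. measure \<nu> (?A m)) \<longlonglongrightarrow> measure \<nu> (\<Inter>m. ?A m)"
    using sets_infinite_narrow by (intro \<nu>.finite_Lim_measure_decseq) auto
  moreover have "(\<Inter>m. ?A m) = {}"
  proof (rule equals0I)
    fix K assume "K \<in> (\<Inter>m. ?A m)"
    then have "K \<subseteq> X" "infinite K" "\<And>m. pattern_count m 0 K \<le> N" by (auto simp: hyperspace_def)
    then show False using infinite_iff_pattern_count[of K q a] by (meson not_le)
  qed
  ultimately show ?thesis by simp
qed

text \<open>Averaging over \<open>t \<in> [0, H)\<close> turns the count of \<open>missing_times_few\<close> into
  \<open>\<nu>(K misses w) \<le> \<nu>(K has at most N patterns) + \<epsilon>\<close> on the invariant event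
  that \<open>K\<close> is infinite. The left-hand side and \<open>N\<close> are independent of the radius
  \<open>m\<close> of the patterns, and the first term on the right tends to \<open>0\<close> for
  \<open>m \<rightarrow> \<infinity>\<close>.\<close>

lemma infinite_misses_null:
  assumes w: "w \<noteq> []" "measure M (cylinder X w) > 0"
  shows "measure \<nu> {K \<in> hyperspace X. infinite K \<and> misses w t K} = 0"
proof -
  define Z where "Z t = {K \<in> hyperspace X. infinite K \<and> misses w t K}" for t
  define W where "W m N t = {K \<in> hyperspace X. infinite K \<and> pattern_count m t K \<le> N}" for m N t
  have sets_Z: "Z t \<in> sets \<nu>" and sets_W: "W m N t \<in> sets \<nu>" for m N t
    unfolding Z_def W_def by (rule sets_infinite_misses sets_infinite_narrow)+
  have Z_eq: "measure \<nu> (Z s) = measure \<nu> (Z 0)" for s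
    using \<nu>_shift(2)[of "\<lambda>K. infinite K \<and> misses w 0 K" s] sets_infinite_misses[of w 0]
    by (simp add: Z_def misses_shift infinite_shift_iff)
  have W_eq: "measure \<nu> (W m N s) = measure \<nu> (W m N 0)" for m N s
    using \<nu>_shift(2)[of "\<lambda>K. infinite K \<and> pattern_count m 0 K \<le> N" s] sets_infinite_narrow[of m 0 N]
    by (simp add: W_def pattern_count_shift infinite_shift_iff)
  have int_Z: "integrable \<nu> (indicat_real (Z t))" for t
    by (rule integrable_real_indicator[OF sets_Z]) (simp add: \<nu>.emeasure_eq_measure)
  have int_W: "integrable \<nu> (indicat_real (W m N t))" for m N t
    by (rule integrable_real_indicator[OF sets_W]) (simp add: \<nu>.emeasure_eq_measure)
  have integral_Z: "integral\<^sup>L \<nu> (indicat_real (Z t)) = measure \<nu> (Z t)" for t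
    using sets.Int_space_eq2[OF sets_Z] by (simp only: Bochner_Integration.integral_indicator)
  have integral_W: "integral\<^sup>L \<nu> (indicat_real (W m N t)) = measure \<nu> (W m N t)" for m N t
    using sets.Int_space_eq2[OF sets_W] by (simp only: Bochner_Integration.integral_indicator)
  have "measure \<nu> (Z 0) \<le> \<epsilon>" if "\<epsilon> > 0" for \<epsilon>
  proof -
    obtain N where N: "\<And>m. \<exists>H>0. \<forall>K\<subseteq>X.
       real (card {t\<in>{0..<int H}. misses w t K}) \<le> real (card {t\<in>{0..<int H}. pattern_count m t K \<le> N}) + \<epsilon> * real H"
      using missing_times_few[OF w \<open>\<epsilon> > 0\<close>] by blast
    have le: "measure \<nu> (Z 0) \<le> measure \<nu> (W m N 0) + \<epsilon>" for m
    proof -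
      obtain H where "H > 0" and H: "\<And>K. K \<subseteq> X \<Longrightarrow> real (card {t\<in>{0..<int H}. misses w t K})
          \<le> real (card {t\<in>{0..<int H}. pattern_count m t K \<le> N}) + \<epsilon> * real H"
        using N by blast
      let ?T = "{0..<int H}"
      have "real H * measure \<nu> (Z 0) = (\<Sum>t\<in>?T. measure \<nu> (Z t))"
        by (subst sum.cong[OF refl Z_eq]) simp
      also have "\<dots> = integral\<^sup>L \<nu> (\<lambda>K. \<Sum>t\<in>?T. indicator (Z t) K)"
        by (simp only: Bochner_Integration.integral_sum[OF int_Z] integral_Z)
      also have "\<dots> \<le> integral\<^sup>L \<nu> (\<lambda>K. (\<Sum>t\<in>?T. indicator (W m N t) K) + \<epsilon> * real H)"
      proof (rule integral_mono)
        show "integrable \<nu> (\<lambda>K. \<Sum>t\<in>?T. indicat_real (Z t) K)"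
          by (intro Bochner_Integration.integrable_sum int_Z)
        show "integrable \<nu> (\<lambda>K. (\<Sum>t\<in>?T. indicat_real (W m N t) K) + \<epsilon> * real H)"
          by (intro Bochner_Integration.integrable_add Bochner_Integration.integrable_sum int_W) simp
        fix K assume "K \<in> space \<nu>"
        then have K: "K \<in> hyperspace X" "K \<subseteq> X" by (auto simp: space_\<nu> hyperspace_def)
        show "(\<Sum>t\<in>?T. indicat_real (Z t) K) \<le> (\<Sum>t\<in>?T. indicat_real (W m N t) K) + \<epsilon> * real H"
        proof (cases "infinite K")
          case True
          then have "(\<Sum>t\<in>?T. indicat_real (Z t) K) = real (card {t\<in>?T. misses w t K})"
            "(\<Sum>t\<in>?T. indicat_real (W m N t) K) = real (card {t\<in>?T. pattern_count m t K \<le> N})"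
            using K(1) by (simp_all add: Z_def W_def indicator_def sum.If_cases Int_def)
          then show ?thesis using H[OF K(2)] by simp
        next
          case False
          then show ?thesis using \<open>\<epsilon> > 0\<close> by (simp add: Z_def indicator_def)
        qed
      qed
      also have "\<dots> = (\<Sum>t\<in>?T. measure \<nu> (W m N t)) + \<epsilon> * real H"
        by (simp add: Bochner_Integration.integral_add Bochner_Integration.integrable_sum
              Bochner_Integration.integral_sum int_W sets.Int_space_eq2[OF sets_W] \<nu>.prob_space)
      also have "\<dots> = real H * (measure \<nu> (W m N 0) + \<epsilon>)"
        by (subst sum.cong[OF refl W_eq]) (simp add: algebra_simps)
      finally show ?thesis using \<open>H > 0\<close> by simp
    qed
    have "(\<lambda>m. measure \<nu> (W m N 0) + \<epsilon>) \<longlonglongrightarrow> 0 + \<epsilon>"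
      unfolding W_def by (intro tendsto_add measure_infinite_narrow_tendsto_0 tendsto_const)
    then show ?thesis using le by (intro LIMSEQ_le_const[of _ "\<epsilon>"]) auto
  qed
  then have "measure \<nu> (Z 0) \<le> 0" by (rule field_le_epsilon[of _ 0, simplified])
  then have "measure \<nu> (Z t) = 0" using Z_eq[of t] measure_nonneg[of \<nu> "Z 0"] by linarith
  then show ?thesis by (simp only: Z_def)
qed

lemma finite_or_full: "measure \<nu> (fin_hyperspace X \<union> {X}) = 1"
proof -
  define I where "I = {(i, w). w \<noteq> [] \<and> (\<exists>y\<in>X. subword y i (i + int (length w)) = w)}"
  let ?Z = "\<lambda>(i, w). {K \<in> hyperspace X. infinite K \<and> misses w i K}"
  have sets_Z: "?Z p \<in> sets \<nu>" for p using sets_infinite_misses by (cases p) auto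
  have null: "(\<Union>p\<in>I. ?Z p) \<in> null_sets \<nu>"
  proof (rule null_sets_UN')
    fix p assume "p \<in> I"
    then obtain i w y where p: "p = (i, w)" "w \<noteq> []" "y \<in> X" "subword y i (i + int (length w)) = w"
      by (auto simp: I_def)
    have "measure \<nu> (?Z p) = 0"
      using infinite_misses_null[OF p(2) cylinder_pos[OF p(3,2,4)]] p(1) by simp
    then show "?Z p \<in> null_sets \<nu>" using sets_Z by (auto simp: null_sets_def \<nu>.emeasure_eq_measure)
  qed simp
  have "fin_hyperspace X \<union> {X} = space \<nu> - (\<Union>p\<in>I. ?Z p)"
  proof (intro equalityI subsetI)
    fix K assume K: "K \<in> fin_hyperspace X \<union> {X}"
    have "K \<in> hyperspace X"
      using K compact_rank_one_subshift[of q a] x_in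
      by (auto simp: fin_hyperspace_def hyperspace_def finite_imp_compact)
    moreover have "K \<notin> ?Z p" if "p \<in> I" for p
      using K that by (auto simp: fin_hyperspace_def I_def misses_def)
    ultimately show "K \<in> space \<nu> - (\<Union>p\<in>I. ?Z p)" by (auto simp: space_\<nu>)
  next
    fix K assume K: "K \<in> space \<nu> - (\<Union>p\<in>I. ?Z p)"
    then have KX: "K \<in> hyperspace X" by (simp add: space_\<nu>)
    show "K \<in> fin_hyperspace X \<union> {X}"
    proof (cases "finite K \<or> K = X")
      case True
      then show ?thesis using KX by (auto simp: fin_hyperspace_def hyperspace_def)
    next
      case False
      then obtain y where y: "y \<in> X" "y \<notin> K" using KX by (auto simp: hyperspace_def)
      have "closed K" using KX by (auto simp: hyperspace_def compact_imp_closed)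
      then obtain m where m: "\<And>z. subword z (- int m) (int m + 1) = subword y (- int m) (int m + 1) \<Longrightarrow> z \<notin> K"
        using cylinder_avoiding_closed y(2) by blast
      let ?w = "subword y (- int m) (int m + 1)"
      have len: "- int m + int (length ?w) = int m + 1" by simp
      have "?w \<noteq> []" by (simp flip: length_greater_0_conv)
      then have "(- int m, ?w) \<in> I" unfolding I_def using y(1) len by auto
      moreover have "K \<in> ?Z (- int m, ?w)"
        using False KX m unfolding misses_def len by auto
      ultimately show ?thesis using K by blast
    qed
  qed
  moreover have "measure \<nu> (space \<nu> - (\<Union>p\<in>I. ?Z p)) = 1"
    using null \<nu>.prob_compl[of "\<Union>p\<in>I. ?Z p"] by (simp add: null_sets_def measure_def)
  ultimately show ?thesis by simp
qed

end

theorem theorem1: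
  fixes q :: "nat \<Rightarrow> nat" and a :: "nat \<Rightarrow> nat \<Rightarrow> nat" and M :: "(int \<Rightarrow> nat) measure"
  assumes "rank_one_map q a M"
    and "measure M (cylinder (rank_one_subshift q a) [1]) > 0"
    and "mixing M left_shift"
  shows "IC_rigid (rank_one_subshift q a) shift_action"
  unfolding IC_rigid_def
proof (intro allI impI)
  fix \<nu> :: "(int \<Rightarrow> nat) set measure"
  assume \<nu>: "prob_space \<nu>" "sets \<nu> = sets (hyperspace_borel (rank_one_subshift q a))"
    "invariant_measure (\<lambda>g K. shift_action g ` K) \<nu>"
  obtain x where "mixing_rank_one q a M x"
    using assms unfolding rank_one_map_def mixing_rank_one_def by auto
  with \<nu> have "invariant_random_compact q a M x \<nu>"
    by (simp add: invariant_random_compact_def invariant_random_compact_axioms_def)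
  then show "measure \<nu> (fin_hyperspace (rank_one_subshift q a) \<union> {rank_one_subshift q a}) = 1"
    by (rule invariant_random_compact.finite_or_full)
qed

end
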